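(* Let $M\ge3$ be an integer. (1) Let $\mathcal{A},\mathcal{B}$ be finite sets of integers (not necessarily contained in $\{0,1,\dots,M-1\}$) with $1<|\mathcal{A}|=|\mathcal{B}|<M$, and put $\delta=\frac{\log|\mathcal{A}|}{\log M}$. If $(\mathcal{A},\mathcal{B})$ is a distributed spectral pair in $\mathbb{Z}_M$, then $\beta(M,\mathcal{A},\mathcal{B})=\frac{1-\delta}{2}$. (2) Conversely, let $\mathcal{A},\mathcal{B}\subset\{0,1,\dots,M-1\}$ with $1<|\mathcal{A}|=|\mathcal{B}|<M$ and $\delta=\frac{\log|\mathcal{A}|}{\log M}$. If $\beta(M,\mathcal{A},\mathcal{B})=\frac{1-\delta}{2}$, then $(\mathcal{A},\mathcal{B})$ is a distributed spectral pair in $\mathbb{Z}_M$.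
   Context: For a nonempty finite set $E\subset\mathbb{R}$, $\nu_E$ is the uniform probability measure on $E$, with Fourier transform $\widehat{\nu_E}(\xi)=\frac{1}{|E|}\sum_{a\in E}e^{-2\pi i\xi a}$ for $\xi\in\mathbb{R}$. Distributed spectral pair: for finite sets of integers $\mathcal{A},\mathcal{B}$ with $|\mathcal{A}|=|\mathcal{B}|$, $(\mathcal{A},\mathcal{B})$ is a distributed spectral pair in $\mathbb{Z}_M$ if for all $b_1\neq b_1'$ in $\mathcal{B}$, either $\widehat{\nu_{\mathcal{A}}}\left(\frac{b_1-b_1'}{M}\right)=0$, or $\widehat{\nu_{\mathcal{A}}}\left(\frac{b_1-b_1'}{M^2}+\frac{b_2-b_2'}{M}\right)=0$ for all $b_2,b_2'\in\mathcal{B}$. For $N\ge1$, $\mathcal{F}_N=\frac{1}{\sqrt N}\left(e^{-2\pi i jl/N}\right)_{0\le j,l\le N-1}$ is the discrete Fourier transform matrix on $\mathbb{C}^{\mathbb{Z}_N}$. For $E\subset\mathbb{Z}_N$, $\mathbf{1}_E$ also denotes the operator of multiplication by the indicator function of $E$. For $k\ge1$, $\mathcal{A}_k=\left\{\sum_{j=0}^{k-1}a_jM^j: a_j\in\mathcal{A}\right\}$, and $\mathcal{B}_k$ is defined in the same way from $\mathcal{B}$; in the operators below they are viewed as subsets of $\mathbb{Z}_{M^k}$ by reduction modulo $M^k$. $\beta(M,\mathcal{A},\mathcal{B})$ is the largest exponent $\beta$, understood as the supremum of all real $\beta$, such that there is a constant $C>0$ independent of $k$ with $\|\mathbf{1}_{\mathcal{A}_k}\mathcal{F}_{M^k}\mathbf{1}_{\mathcal{B}_k}\|_{\ell^2\to\ell^2}\le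 C\,M^{-k\beta}$ for all $k\ge1$, where $\|\cdot\|_{\ell^2\to\ell^2}$ is the operator norm with respect to the Euclidean norm. *)

theory Defs
  imports "HOL-Analysis.L2_Norm" "Jordan_Normal_Form.Matrix"
begin

text \<open>Fourier transform of the uniform probability measure on a finite nonempty set of reals.\<close>

definition uniform_fourier :: "real set \<Rightarrow> real \<Rightarrow> complex" where
  "uniform_fourier E \<xi> = (1 / of_nat (card E)) * (\<Sum>a\<in>E. cis (- 2 * pi * \<xi> * a))"

definition distributed_spectral_pair :: "nat \<Rightarrow> int set \<Rightarrow> int set \<Rightarrow> bool" where
  "distributed_spectral_pair M A B \<longleftrightarrow>
     finite A \<and> finite B \<and> card A = card B \<and>
     (\<forall>b1\<in>B. \<forall>b1'\<in>B. b1 \<noteq> b1' \<longrightarrow>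
        uniform_fourier (real_of_int ` A) (real_of_int (b1 - b1') / real M) = 0 \<or>
        (\<forall>b2\<in>B. \<forall>b2'\<in>B.
           uniform_fourier (real_of_int ` A)
             (real_of_int (b1 - b1') / real M ^ 2 + real_of_int (b2 - b2') / real M) = 0))"

definition dft_mat :: "nat \<Rightarrow> complex mat" where
  "dft_mat N =
     mat N N (\<lambda>(j, l). of_real (1 / sqrt (real N)) * cis (- 2 * pi * real j * real l / real N))"

text \<open>Multiplication by the indicator function of a subset of \<open>\<int>\<^sub>N\<close>, where \<open>\<int>\<^sub>N\<close> is represented
  by the indices \<open>0, \<dots>, N - 1\<close>.\<close>

definition indicator_mat :: "nat \<Rightarrow> nat set \<Rightarrow> complex mat" where
  "indicator_mat N E = mat_diag N (\<lambda>i. if i \<in> E then 1 else 0)"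

definition l2_norm_vec :: "complex vec \<Rightarrow> real" where
  "l2_norm_vec v = L2_set (\<lambda>i. cmod (v $ i)) {..<dim_vec v}"

definition l2_op_norm :: "complex mat \<Rightarrow> real" where
  "l2_op_norm T = Sup {l2_norm_vec (T *\<^sub>v v) | v. v \<in> carrier_vec (dim_col T) \<and> l2_norm_vec v \<le> 1}"

definition digit_set :: "nat \<Rightarrow> int set \<Rightarrow> nat \<Rightarrow> int set" where
  "digit_set M A k = {\<Sum>j<k. a j * int M ^ j | a. \<forall>j<k. a j \<in> A}"

definition residues_of :: "nat \<Rightarrow> int set \<Rightarrow> nat set" where
  "residues_of N S = (\<lambda>x. nat (x mod int N)) ` S"

definition uncertainty_norm :: "nat \<Rightarrow> int set \<Rightarrow> int set \<Rightarrow> nat \<Rightarrow> real" where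
  "uncertainty_norm M A B k =
     l2_op_norm (indicator_mat (M ^ k) (residues_of (M ^ k) (digit_set M A k))
               * dft_mat (M ^ k)
               * indicator_mat (M ^ k) (residues_of (M ^ k) (digit_set M B k)))"

text \<open>The exponent \<open>\<beta>(M, A, B)\<close>. For \<open>M \<ge> 2\<close> and nonempty \<open>A\<close>, \<open>B\<close> the set below contains \<open>0\<close>
  (the norms are at most \<open>1\<close>) and is bounded above by \<open>1/2\<close> (the matrix has an entry of modulus
  \<open>M powr (- k / 2)\<close>), so the supremum in the reals is the actual one.\<close>

definition uncertainty_exponent :: "nat \<Rightarrow> int set \<Rightarrow> int set \<Rightarrow> real" where
  "uncertainty_exponent M A B =
     Sup {\<beta>. \<exists>C>0. \<forall>k\<ge>1. uncertainty_norm M A B k \<le> C * real M powr (- real k * \<beta>)}"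

end

theory Submission
  imports Defs "HOL-Library.FuncSet"
begin

text \<open>
  Write \<open>n = |A| = |B|\<close>, let \<open>\<nu>\<close> be the Fourier transform of the uniform measure on \<open>A\<close>, and put
  \<open>h\<^sub>k(t) = \<nu>(t/M) \<nu>(t/M\<^sup>2) \<dots> \<nu>(t/M\<^sup>k)\<close>, called \<open>scale_prod\<close> below. The exponential sum over the
  words of \<open>k\<close> digits from \<open>A\<close> factors over the digits, so that, up to complex conjugation and with rows
  counted once for every word, the columns \<open>y\<close> and \<open>y'\<close> of the matrix have inner product
  \<open>(n/M)\<^sup>k h\<^sub>k(y - y')\<close>. Both halves of the theorem are read off this Gram kernel. The candidate exponent \<open>(1 - \<delta>)/2\<close> is the one for which
  the square of the norm decays like \<open>(n/M)\<^sup>k\<close>.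

  \<^emph>\<open>Distributed pairs.\<close> Let two words first differ at digit \<open>i\<close>, which is not the last one.
  As \<open>\<nu>\<close> has period 1, the factors \<open>s = i + 1\<close> and \<open>s = i + 2\<close> of \<open>h\<^sub>k\<close> at their difference
  only see the digits \<open>i\<close> and \<open>i + 1\<close>, and they are exactly the two
  quantities of which the hypothesis makes one vanish (\<open>distributed_scale_prod_zero\<close>). Hence
  the Gram kernel has at most \<open>n\<close> nonzero entries in a row, and the square of the norm is at most
  \<open>n (n/M)\<^sup>k\<close>. The digits need not be reduced modulo \<open>M\<close>, so that different words may have
  values congruent modulo \<open>M\<^sup>k\<close>; but then \<open>h\<^sub>k\<close> is 1 at the difference, so by the same vanishing they
  agree before the last digit. Thus at least \<open>n\<^sup>k\<^sup>-\<^sup>1\<close> residues occur, and one row of the matrix shows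
  that the square of the norm is at least \<open>n\<^sup>k\<^sup>-\<^sup>1/M\<^sup>k\<close>.

  \<^emph>\<open>Pairs that are not distributed.\<close> Applying the adjoint matrix to one of the columns bounds the square
  of the norm below by \<open>(n/M)\<^sup>k\<close> times the sum over all words \<open>b\<close> of \<open>|h\<^sub>k|\<^sup>2\<close> at the difference of
  \<open>b\<close> and a fixed word, for every choice of that fixed word (\<open>uncertainty_norm_sq_ge_column\<close>). It
  suffices that for a good choice this sum grows exponentially. If some nonzero difference \<open>D\<close> of
  values keeps \<open>|h\<^sub>k(D)|\<close> away from 0 for all \<open>k\<close>, then so it does: cut the words into long blocks
  and let each block differ from the fixed word either by 0 or by \<open>D\<close>. The two choices contribute
  about \<open>1 + |h(D)|\<^sup>2\<close>, and earlier blocks disturb a later one only slightly because \<open>h\<^sub>k\<close> is Lipschitz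
  uniformly in \<open>k\<close> (\<open>two_branch_gain\<close>, \<open>column_growth\<close>).

  The crux is the existence of \<open>D\<close> (\<open>persistent_difference\<close>). Failure of the distributed condition gives
  digit differences \<open>d\<close> and \<open>e\<close> for which the first two factors at \<open>d + M e\<close> are nonzero, but says nothing
  about the later ones. For digits in \<open>{0, \<dots>, M - 1}\<close> there are no zeros of \<open>\<nu>\<close> within
  \<open>1/(2M)\<close> of 0, which settles all factors from the fourth on. Moreover \<open>\<nu>\<close> has at most one zero in
  \<open>(0, 1/M)\<close> (\<open>digit_ft_zero_unique\<close>): at two such zeros a suitable combination of two cosine
  sums would vanish although all its terms are positive. If \<open>\<nu>(d/M\<^sup>2)\<close> is nonzero, take \<open>D = d\<close>.
  Otherwise take \<open>D = d + M e\<close>: a zero at \<open>D/M\<^sup>3\<close> would have to coincide up to sign with the one at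
  \<open>d/M\<^sup>2\<close>, which forces \<open>M\<close> to divide \<open>d\<close>.
\<close>

section \<open>Localized discrete Fourier matrices\<close>

lemma l2_norm_vec_nonneg: "0 \<le> l2_norm_vec v"
  by (simp add: l2_norm_vec_def)

lemma l2_norm_vec_sq: "(l2_norm_vec v)\<^sup>2 = (\<Sum>i<dim_vec v. (cmod (v $ i))\<^sup>2)"
  by (simp add: l2_norm_vec_def L2_set_def sum_nonneg)

lemma l2_norm_vec_smult: "l2_norm_vec (c \<cdot>\<^sub>v v) = cmod c * l2_norm_vec v"
proof -
  have "l2_norm_vec (c \<cdot>\<^sub>v v) = L2_set (\<lambda>i. cmod c * cmod (v $ i)) {..<dim_vec v}"
    unfolding l2_norm_vec_def by (intro L2_set_cong) (auto simp: norm_mult)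
  then show ?thesis
    by (simp add: L2_set_right_distrib l2_norm_vec_def)
qed

lemma l2_op_norm_le:
  assumes "0 \<le> c"
    and "\<And>v. v \<in> carrier_vec (dim_col T) \<Longrightarrow> l2_norm_vec (T *\<^sub>v v) \<le> c * l2_norm_vec v"
  shows "l2_op_norm T \<le> c"
  unfolding l2_op_norm_def
proof (rule cSup_least)
  have "l2_norm_vec (T *\<^sub>v 0\<^sub>v (dim_col T)) \<in> {l2_norm_vec (T *\<^sub>v v) |v. v \<in> carrier_vec (dim_col T) \<and> l2_norm_vec v \<le> 1}"
    by (rule CollectI, rule exI[of _ "0\<^sub>v (dim_col T)"]) (simp add: l2_norm_vec_def L2_set_def)
  then show "{l2_norm_vec (T *\<^sub>v v) |v. v \<in> carrier_vec (dim_col T) \<and> l2_norm_vec v \<le> 1} \<noteq> {}"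
    by blast
next
  fix x assume "x \<in> {l2_norm_vec (T *\<^sub>v v) |v. v \<in> carrier_vec (dim_col T) \<and> l2_norm_vec v \<le> 1}"
  then obtain v where v: "v \<in> carrier_vec (dim_col T)" "l2_norm_vec v \<le> 1" "x = l2_norm_vec (T *\<^sub>v v)"
    by blast
  have "x \<le> c * l2_norm_vec v" using v assms(2) by simp
  also have "\<dots> \<le> c * 1" using v assms(1) by (intro mult_left_mono)
  finally show "x \<le> c" by simp
qed

text \<open>
  Since \<open>l2_op_norm\<close> is a supremum of reals, it bounds anything only once the supremum is known to be
  over a bounded set; the first assumption provides this.
\<close>

lemma l2_norm_mult_vec_le_op_norm:
  assumes bounded: "\<And>v. v \<in> carrier_vec (dim_col T) \<Longrightarrow> l2_norm_vec (T *\<^sub>v v) \<le> c * l2_norm_vec v"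
    and v: "v \<in> carrier_vec (dim_col T)"
  shows "l2_norm_vec (T *\<^sub>v v) \<le> l2_op_norm T * l2_norm_vec v"
proof (cases "l2_norm_vec v = 0")
  case True
  then show ?thesis using bounded[OF v] by simp
next
  case False
  then have pos: "l2_norm_vec v > 0" using l2_norm_vec_nonneg[of v] by simp
  define S where "S = {l2_norm_vec (T *\<^sub>v v) |v. v \<in> carrier_vec (dim_col T) \<and> l2_norm_vec v \<le> 1}"
  define w where "w = complex_of_real (1 / l2_norm_vec v) \<cdot>\<^sub>v v"
  have w: "w \<in> carrier_vec (dim_col T)" using v by (simp add: w_def)
  have "l2_norm_vec w = 1"
    using pos by (simp add: w_def l2_norm_vec_smult norm_divide)
  with w have inS: "l2_norm_vec (T *\<^sub>v w) \<in> S"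
    unfolding S_def by (intro CollectI exI[of _ w]) simp
  have "bdd_above S"
  proof (rule bdd_aboveI[of _ "\<bar>c\<bar>"])
    fix x assume "x \<in> S"
    then obtain u where u: "u \<in> carrier_vec (dim_col T)" "l2_norm_vec u \<le> 1" "x = l2_norm_vec (T *\<^sub>v u)"
      unfolding S_def by blast
    have "x \<le> c * l2_norm_vec u" using u bounded by simp
    also have "\<dots> \<le> \<bar>c\<bar> * l2_norm_vec u" by (simp add: mult_right_mono l2_norm_vec_nonneg)
    also have "\<dots> \<le> \<bar>c\<bar> * 1" using u by (intro mult_left_mono) auto
    finally show "x \<le> \<bar>c\<bar>" by simp
  qed
  then have le: "l2_norm_vec (T *\<^sub>v w) \<le> l2_op_norm T"
    unfolding l2_op_norm_def S_def[symmetric] by (intro cSup_upper inS)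
  have "T *\<^sub>v w = complex_of_real (1 / l2_norm_vec v) \<cdot>\<^sub>v (T *\<^sub>v v)"
    unfolding w_def by (rule mult_mat_vec[of _ "dim_row T" "dim_col T"]) (use v in auto)
  then have "l2_norm_vec (T *\<^sub>v w) = l2_norm_vec (T *\<^sub>v v) / l2_norm_vec v"
    using pos by (simp add: l2_norm_vec_smult norm_divide)
  then show ?thesis using le pos by (simp only: pos_divide_le_eq)
qed

definition localized_dft :: "nat \<Rightarrow> nat set \<Rightarrow> nat set \<Rightarrow> complex mat" where
  "localized_dft N X Y = indicator_mat N X * dft_mat N * indicator_mat N Y"

lemma localized_dft_carrier: "localized_dft N X Y \<in> carrier_mat N N"
  unfolding localized_dft_def indicator_mat_def dft_mat_def
  by (intro mult_carrier_mat[of _ N N] mat_diag_dim mat_carrier)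

lemma localized_dft_index:
  assumes "j < N" "l < N"
  shows "localized_dft N X Y $$ (j, l) =
    (if j \<in> X \<and> l \<in> Y then of_real (1 / sqrt (real N)) * cis (- 2 * pi * real j * real l / real N) else 0)"
proof -
  have D: "dft_mat N \<in> carrier_mat N N" by (simp add: dft_mat_def)
  have left: "indicator_mat N X * dft_mat N =
      mat N N (\<lambda>(i, j). (if i \<in> X then 1 else 0) * dft_mat N $$ (i, j))"
    unfolding indicator_mat_def by (rule mat_diag_mult_left[OF D])
  have "localized_dft N X Y =
      mat N N (\<lambda>(i, j). mat N N (\<lambda>(i, j). (if i \<in> X then 1 else 0) * dft_mat N $$ (i, j)) $$ (i, j)
        * (if j \<in> Y then 1 else 0))"
    unfolding localized_dft_def left unfolding indicator_mat_def by (rule mat_diag_mult_right) simp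
  then show ?thesis
    using assms by (simp add: dft_mat_def)
qed

lemma localized_dft_norm_sq:
  assumes X: "X \<subseteq> {..<N}" and Y: "Y \<subseteq> {..<N}" and v: "v \<in> carrier_vec N"
  shows "(l2_norm_vec (localized_dft N X Y *\<^sub>v v))\<^sup>2 =
    (\<Sum>j\<in>X. (cmod (\<Sum>l\<in>Y. cis (- 2 * pi * real j * real l / real N) * v $ l))\<^sup>2) / real N"
proof -
  have dims: "dim_row (localized_dft N X Y) = N" "dim_col (localized_dft N X Y) = N"
    using localized_dft_carrier[of N X Y] by auto
  define s where "s j = (\<Sum>l\<in>Y. cis (- 2 * pi * real j * real l / real N) * v $ l)" for j :: nat
  have entry: "(localized_dft N X Y *\<^sub>v v) $ j = (if j \<in> X then of_real (1 / sqrt (real N)) * s j else 0)"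
    if j: "j < N" for j
  proof -
    have "(localized_dft N X Y *\<^sub>v v) $ j = (\<Sum>l<N. localized_dft N X Y $$ (j, l) * v $ l)"
      using j v dims by (simp add: scalar_prod_def lessThan_atLeast0)
    also have "\<dots> = (\<Sum>l<N. if l \<in> Y then (if j \<in> X then of_real (1 / sqrt (real N)) * (cis (- 2 * pi * real j * real l / real N) * v $ l) else 0) else 0)"
      using j by (intro sum.cong) (auto simp: localized_dft_index)
    also have "\<dots> = (\<Sum>l\<in>{..<N} \<inter> Y. if j \<in> X then of_real (1 / sqrt (real N)) * (cis (- 2 * pi * real j * real l / real N) * v $ l) else 0)"
      by (subst sum.inter_restrict) auto
    also have "{..<N} \<inter> Y = Y" using Y by auto
    finally show ?thesis by (simp add: s_def sum_distrib_left)
  qed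
  have "(l2_norm_vec (localized_dft N X Y *\<^sub>v v))\<^sup>2 = (\<Sum>j<N. (cmod ((localized_dft N X Y *\<^sub>v v) $ j))\<^sup>2)"
    by (simp add: l2_norm_vec_sq dims)
  also have "\<dots> = (\<Sum>j<N. if j \<in> X then (cmod (s j))\<^sup>2 / real N else 0)"
    by (intro sum.cong) (auto simp: entry norm_mult power_mult_distrib norm_divide power_divide)
  also have "\<dots> = (\<Sum>j\<in>{..<N} \<inter> X. (cmod (s j))\<^sup>2 / real N)"
    by (subst sum.inter_restrict) auto
  also have "{..<N} \<inter> X = X" using X by auto
  finally show ?thesis by (simp add: s_def sum_divide_distrib)
qed

text \<open>
  Reduces operator bounds to inequalities for exponential sums over \<open>X\<close> and \<open>Y\<close> without matrices.
\<close>

lemma localized_dft_mult_vec_le: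
  assumes X: "X \<subseteq> {..<N}" and Y: "Y \<subseteq> {..<N}" and N: "0 < N" and c: "0 \<le> c"
    and bound: "\<And>f. (\<Sum>j\<in>X. (cmod (\<Sum>l\<in>Y. cis (- 2 * pi * real j * real l / real N) * f l))\<^sup>2)
        \<le> c\<^sup>2 * real N * (\<Sum>l\<in>Y. (cmod (f l))\<^sup>2)"
    and v: "v \<in> carrier_vec N"
  shows "l2_norm_vec (localized_dft N X Y *\<^sub>v v) \<le> c * l2_norm_vec v"
proof (rule power2_le_imp_le)
  have "(l2_norm_vec (localized_dft N X Y *\<^sub>v v))\<^sup>2 \<le> c\<^sup>2 * (\<Sum>l\<in>Y. (cmod (v $ l))\<^sup>2)"
    unfolding localized_dft_norm_sq[OF X Y v] using bound[of "\<lambda>l. v $ l"] N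
    by (simp only: pos_divide_le_eq of_nat_0_less_iff mult_ac)
  also have "\<dots> \<le> c\<^sup>2 * (\<Sum>l<N. (cmod (v $ l))\<^sup>2)"
    using Y by (intro mult_left_mono sum_mono2) auto
  also have "\<dots> = (c * l2_norm_vec v)\<^sup>2"
    using v by (simp add: power_mult_distrib l2_norm_vec_sq)
  finally show "(l2_norm_vec (localized_dft N X Y *\<^sub>v v))\<^sup>2 \<le> (c * l2_norm_vec v)\<^sup>2" .
qed (simp add: c l2_norm_vec_nonneg)

lemma localized_dft_op_norm_le:
  assumes X: "X \<subseteq> {..<N}" and Y: "Y \<subseteq> {..<N}" and N: "0 < N" and c: "0 \<le> c"
    and bound: "\<And>f. (\<Sum>j\<in>X. (cmod (\<Sum>l\<in>Y. cis (- 2 * pi * real j * real l / real N) * f l))\<^sup>2)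
        \<le> c\<^sup>2 * real N * (\<Sum>l\<in>Y. (cmod (f l))\<^sup>2)"
  shows "l2_op_norm (localized_dft N X Y) \<le> c"
proof -
  have "dim_col (localized_dft N X Y) = N" using localized_dft_carrier[of N X Y] by auto
  then show ?thesis
    by (intro l2_op_norm_le[OF c]) (simp add: localized_dft_mult_vec_le[OF X Y N c bound])
qed

lemma cmod_sum_cis_sq_le:
  assumes "finite Y"
  shows "(cmod (\<Sum>l\<in>Y. cis (\<theta> l) * f l))\<^sup>2 \<le> real (card Y) * (\<Sum>l\<in>Y. (cmod (f l))\<^sup>2)"
proof -
  have "cmod (\<Sum>l\<in>Y. cis (\<theta> l) * f l) \<le> (\<Sum>l\<in>Y. \<bar>1\<bar> * \<bar>cmod (f l)\<bar>)"
    by (rule order_trans[OF norm_sum]) (simp add: norm_mult)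
  also have "\<dots> \<le> L2_set (\<lambda>l. 1) Y * L2_set (\<lambda>l. cmod (f l)) Y"
    by (rule L2_set_mult_ineq)
  finally have "(cmod (\<Sum>l\<in>Y. cis (\<theta> l) * f l))\<^sup>2 \<le> (L2_set (\<lambda>l. 1) Y * L2_set (\<lambda>l. cmod (f l)) Y)\<^sup>2"
    by (intro power_mono) auto
  also have "\<dots> = real (card Y) * (\<Sum>l\<in>Y. (cmod (f l))\<^sup>2)"
    by (simp add: power_mult_distrib L2_set_def sum_nonneg)
  finally show ?thesis .
qed

text \<open>
  A crude bound by Cauchy--Schwarz. It makes the supremum in \<open>l2_op_norm\<close> one over a bounded set.
\<close>

lemma localized_dft_trivial_bound:
  assumes X: "X \<subseteq> {..<N}" and Y: "Y \<subseteq> {..<N}"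
  shows "(\<Sum>j\<in>X. (cmod (\<Sum>l\<in>Y. cis (- 2 * pi * real j * real l / real N) * f l))\<^sup>2)
        \<le> (sqrt (real N))\<^sup>2 * real N * (\<Sum>l\<in>Y. (cmod (f l))\<^sup>2)"
proof -
  have fin: "finite X" "finite Y" using X Y finite_subset by auto
  have card: "card X \<le> N" "card Y \<le> N" using X Y card_mono[of "{..<N}"] by auto
  have "(\<Sum>j\<in>X. (cmod (\<Sum>l\<in>Y. cis (- 2 * pi * real j * real l / real N) * f l))\<^sup>2)
      \<le> (\<Sum>j\<in>X. real (card Y) * (\<Sum>l\<in>Y. (cmod (f l))\<^sup>2))"
    by (intro sum_mono cmod_sum_cis_sq_le fin)
  also have "\<dots> = (real (card X) * real (card Y)) * (\<Sum>l\<in>Y. (cmod (f l))\<^sup>2)" by simp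
  also have "\<dots> \<le> (real N * real N) * (\<Sum>l\<in>Y. (cmod (f l))\<^sup>2)"
    using card by (intro mult_right_mono mult_mono sum_nonneg) auto
  finally show ?thesis by simp
qed

lemma localized_dft_op_norm_le_sqrt:
  assumes "X \<subseteq> {..<N}" "Y \<subseteq> {..<N}" "0 < N"
  shows "l2_op_norm (localized_dft N X Y) \<le> sqrt (real N)"
  using localized_dft_op_norm_le[OF assms _ localized_dft_trivial_bound[OF assms(1,2)]]
  by simp

lemma l2_op_norm_localized_nonneg:
  assumes "X \<subseteq> {..<N}" "Y \<subseteq> {..<N}" "0 < N"
  shows "0 \<le> l2_op_norm (localized_dft N X Y)"
proof -
  have dims: "dim_col (localized_dft N X Y) = N" "dim_row (localized_dft N X Y) = N"
    using localized_dft_carrier[of N X Y] by auto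
  have "l2_norm_vec (localized_dft N X Y *\<^sub>v unit_vec N 0)
      \<le> l2_op_norm (localized_dft N X Y) * l2_norm_vec (unit_vec N 0)"
    by (rule l2_norm_mult_vec_le_op_norm[where c = "sqrt (real N)"])
      (auto simp: dims intro!: localized_dft_mult_vec_le[OF assms] localized_dft_trivial_bound[OF assms(1,2)])
  moreover have "l2_norm_vec (unit_vec N 0) = 1"
  proof -
    have "(l2_norm_vec (unit_vec N 0))\<^sup>2 = (\<Sum>i<N. if i = 0 then 1 else 0)"
      unfolding l2_norm_vec_sq by (intro sum.cong) auto
    also have "\<dots> = 1" using assms(3) by simp
    finally show ?thesis using l2_norm_vec_nonneg[of "unit_vec N 0"] by (simp add: power2_eq_1_iff)
  qed
  ultimately show ?thesis using l2_norm_vec_nonneg order_trans by fastforce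
qed

lemma localized_dft_apply_le:
  assumes X: "X \<subseteq> {..<N}" and Y: "Y \<subseteq> {..<N}" and N: "0 < N"
  shows "(\<Sum>j\<in>X. (cmod (\<Sum>l\<in>Y. cis (- 2 * pi * real j * real l / real N) * f l))\<^sup>2)
        \<le> (l2_op_norm (localized_dft N X Y))\<^sup>2 * real N * (\<Sum>l\<in>Y. (cmod (f l))\<^sup>2)"
proof -
  define v where "v = vec N (\<lambda>l. if l \<in> Y then f l else 0)"
  have v: "v \<in> carrier_vec N" by (simp add: v_def)
  have vY: "v $ l = f l" if "l \<in> Y" for l using that Y by (auto simp: v_def)
  have dims: "dim_col (localized_dft N X Y) = N" using localized_dft_carrier[of N X Y] by auto
  have "l2_norm_vec (localized_dft N X Y *\<^sub>v v) \<le> l2_op_norm (localized_dft N X Y) * l2_norm_vec v"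
    by (rule l2_norm_mult_vec_le_op_norm[where c = "sqrt (real N)"])
      (auto simp: dims v intro!: localized_dft_mult_vec_le[OF X Y N] localized_dft_trivial_bound[OF X Y])
  then have "(l2_norm_vec (localized_dft N X Y *\<^sub>v v))\<^sup>2 \<le> (l2_op_norm (localized_dft N X Y) * l2_norm_vec v)\<^sup>2"
    by (intro power_mono l2_norm_vec_nonneg)
  moreover have "(l2_norm_vec v)\<^sup>2 = (\<Sum>l\<in>Y. (cmod (f l))\<^sup>2)"
  proof -
    have "(l2_norm_vec v)\<^sup>2 = (\<Sum>l<N. if l \<in> Y then (cmod (f l))\<^sup>2 else 0)"
      unfolding l2_norm_vec_sq by (intro sum.cong) (auto simp: v_def)
    also have "\<dots> = (\<Sum>l\<in>{..<N} \<inter> Y. (cmod (f l))\<^sup>2)"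
      by (subst sum.inter_restrict) auto
    also have "{..<N} \<inter> Y = Y" using Y by auto
    finally show ?thesis .
  qed
  moreover have "(l2_norm_vec (localized_dft N X Y *\<^sub>v v))\<^sup>2 =
      (\<Sum>j\<in>X. (cmod (\<Sum>l\<in>Y. cis (- 2 * pi * real j * real l / real N) * f l))\<^sup>2) / real N"
    unfolding localized_dft_norm_sq[OF X Y v] using vY by (simp cong: sum.cong)
  ultimately show ?thesis
    using N by (simp only: power_mult_distrib pos_divide_le_eq of_nat_0_less_iff mult_ac)
qed

text \<open>
  The adjoint has the same norm: if \<open>u\<close> is the image of \<open>g\<close> under the adjoint, then \<open>\<parallel>u\<parallel>\<^sup>2\<close> is the
  inner product of \<open>g\<close> with the image of \<open>u\<close>, to which Cauchy--Schwarz applies. All lower bounds for the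
  norm come from suitable choices of \<open>g\<close>.
\<close>

lemma localized_dft_adjoint_le:
  assumes X: "X \<subseteq> {..<N}" and Y: "Y \<subseteq> {..<N}" and N: "0 < N"
  shows "(\<Sum>l\<in>Y. (cmod (\<Sum>j\<in>X. cis (2 * pi * real j * real l / real N) * g j))\<^sup>2)
        \<le> (l2_op_norm (localized_dft N X Y))\<^sup>2 * real N * (\<Sum>j\<in>X. (cmod (g j))\<^sup>2)"
proof -
  define u where "u l = (\<Sum>j\<in>X. cis (2 * pi * real j * real l / real N) * g j)" for l :: nat
  define w where "w j = (\<Sum>l\<in>Y. cis (- 2 * pi * real j * real l / real N) * u l)" for j :: nat
  define U where "U = (\<Sum>l\<in>Y. (cmod (u l))\<^sup>2)"
  define R where "R = (l2_op_norm (localized_dft N X Y))\<^sup>2 * real N"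
  define G where "G = (\<Sum>j\<in>X. (cmod (g j))\<^sup>2)"
  have pos: "0 \<le> U" "0 \<le> R" "0 \<le> G" by (auto simp: U_def R_def G_def intro!: sum_nonneg)
  have wle: "(\<Sum>j\<in>X. (cmod (w j))\<^sup>2) \<le> R * U"
    unfolding U_def R_def w_def by (rule localized_dft_apply_le[OF X Y N])
  have "complex_of_real U = (\<Sum>l\<in>Y. u l * cnj (u l))"
    unfolding U_def of_real_sum by (intro sum.cong refl) (simp only: complex_norm_square)
  also have "\<dots> = (\<Sum>l\<in>Y. \<Sum>j\<in>X. cis (- 2 * pi * real j * real l / real N) * u l * cnj (g j))"
  proof (intro sum.cong refl)
    fix l
    have "cnj (u l) = (\<Sum>j\<in>X. cis (- 2 * pi * real j * real l / real N) * cnj (g j))"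
      by (simp add: u_def cis_cnj)
    then show "u l * cnj (u l) = (\<Sum>j\<in>X. cis (- 2 * pi * real j * real l / real N) * u l * cnj (g j))"
      by (simp add: sum_distrib_left mult_ac)
  qed
  also have "\<dots> = (\<Sum>j\<in>X. w j * cnj (g j))"
    by (subst sum.swap) (simp add: w_def sum_distrib_right)
  finally have "cmod (complex_of_real U) = cmod (\<Sum>j\<in>X. w j * cnj (g j))"
    by (rule arg_cong)
  then have "U = cmod (\<Sum>j\<in>X. w j * cnj (g j))"
    using pos by simp
  also have "\<dots> \<le> (\<Sum>j\<in>X. \<bar>cmod (w j)\<bar> * \<bar>cmod (g j)\<bar>)"
    by (rule order_trans[OF norm_sum]) (simp add: norm_mult)
  also have "\<dots> \<le> L2_set (\<lambda>j. cmod (w j)) X * L2_set (\<lambda>j. cmod (g j)) X"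
    by (rule L2_set_mult_ineq)
  finally have "U\<^sup>2 \<le> (L2_set (\<lambda>j. cmod (w j)) X * L2_set (\<lambda>j. cmod (g j)) X)\<^sup>2"
    using pos by (intro power_mono) auto
  also have "\<dots> = (\<Sum>j\<in>X. (cmod (w j))\<^sup>2) * G"
    by (simp add: power_mult_distrib L2_set_def sum_nonneg G_def)
  also have "\<dots> \<le> (R * U) * G"
    by (intro mult_right_mono wle pos)
  finally have sq: "U * U \<le> U * (R * G)"
    by (simp add: power2_eq_square mult_ac)
  have "U \<le> R * G"
  proof (cases "U = 0")
    case True
    then show ?thesis using pos by simp
  next
    case False
    with pos sq show ?thesis by simp
  qed
  then show ?thesis by (simp add: U_def R_def G_def u_def)
qed

section \<open>Fourier transforms of digit sets\<close>

abbreviation digit_ft :: "int set \<Rightarrow> real \<Rightarrow> complex" where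
  "digit_ft A \<xi> \<equiv> uniform_fourier (real_of_int ` A) \<xi>"

text \<open>
  The Fourier transform of the uniform measure on the words of \<open>k\<close> digits from \<open>A\<close>, pushed to their
  values, at the frequency \<open>t / M ^ k\<close>; see \<open>sum_digits_cis\<close>. With this scaling of the argument,
  integer multiples of \<open>M ^ k\<close> are periods.
\<close>

definition scale_prod :: "nat \<Rightarrow> int set \<Rightarrow> nat \<Rightarrow> real \<Rightarrow> complex" where
  "scale_prod M A k t = (\<Prod>s<k. digit_ft A (t / real M ^ Suc s))"

lemma digit_ft_eq: "digit_ft A \<xi> = (\<Sum>a\<in>A. cis (- 2 * pi * \<xi> * real_of_int a)) / of_nat (card A)"
proof -
  have inj: "inj_on real_of_int A" by (simp add: inj_on_def)
  then show ?thesis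
    by (simp add: uniform_fourier_def card_image sum.reindex)
qed

lemma digit_ft_0:
  assumes "finite A" "A \<noteq> {}"
  shows "digit_ft A 0 = 1"
  using assms by (simp add: digit_ft_eq)

lemma cis_add_int_period: "cis (x + 2 * pi * of_int m) = cis x"
  by (simp add: cis_mult[symmetric] cis_multiple_2pi)

lemma digit_ft_add_int: "digit_ft A (\<xi> + of_int m) = digit_ft A \<xi>"
proof -
  have "cis (- 2 * pi * (\<xi> + of_int m) * of_int a) = cis (- 2 * pi * \<xi> * of_int a)" for a :: int
    using cis_add_int_period[of "- 2 * pi * \<xi> * of_int a" "- m * a"] by (simp add: algebra_simps)
  then show ?thesis by (simp add: digit_ft_eq)
qed

lemma cmod_digit_ft_le_1: "cmod (digit_ft A \<xi>) \<le> 1"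
proof -
  have "cmod (\<Sum>a\<in>A. cis (- 2 * pi * \<xi> * real_of_int a)) \<le> (\<Sum>a\<in>A. 1)"
    by (rule order_trans[OF norm_sum]) simp
  then show ?thesis
    by (cases "card A = 0") (auto simp: digit_ft_eq norm_divide divide_le_eq)
qed

lemma digit_ft_uminus: "digit_ft A (- \<xi>) = cnj (digit_ft A \<xi>)"
  by (simp add: digit_ft_eq cis_cnj)

lemma scale_prod_0: "finite A \<Longrightarrow> A \<noteq> {} \<Longrightarrow> scale_prod M A k 0 = 1"
  by (simp add: scale_prod_def digit_ft_0)

lemma scale_prod_uminus: "scale_prod M A k (- t) = cnj (scale_prod M A k t)"
  by (simp add: scale_prod_def digit_ft_uminus)

lemma cmod_scale_prod_le_1: "cmod (scale_prod M A k t) \<le> 1"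
  unfolding scale_prod_def prod_norm[symmetric] by (intro prod_le_1) (simp add: cmod_digit_ft_le_1)

lemma scale_prod_add:
  "scale_prod M A (k + m) t = scale_prod M A k t * scale_prod M A m (t / real M ^ k)"
proof -
  have "scale_prod M A (k + m) t = (\<Prod>s<k. digit_ft A (t / real M ^ Suc s)) * (\<Prod>s<m. digit_ft A (t / real M ^ Suc (k + s)))"
    unfolding scale_prod_def by (induction m) (simp_all add: mult.assoc)
  then show ?thesis
    by (simp add: scale_prod_def power_add mult_ac)
qed

lemma scale_prod_add_multiple:
  assumes "M > 0"
  shows "scale_prod M A k (t + real M ^ k * of_int m) = scale_prod M A k t"
  unfolding scale_prod_def
proof (rule prod.cong[OF refl])
  fix s assume "s \<in> {..<k}"
  then have k: "k = Suc s + (k - Suc s)" by simp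
  have "real M ^ k = real M ^ Suc s * real M ^ (k - Suc s)"
    by (subst k) (rule power_add)
  then have "(t + real M ^ k * of_int m) / real M ^ Suc s = t / real M ^ Suc s + of_int (int M ^ (k - Suc s) * m)"
    using assms by (simp add: add_divide_distrib)
  then show "digit_ft A ((t + real M ^ k * of_int m) / real M ^ Suc s) = digit_ft A (t / real M ^ Suc s)"
    by (simp only: digit_ft_add_int)
qed

text \<open>
  The leading digits, collected in \<open>z\<close>, do not influence the first \<open>k\<close> factors, and the trailing part
  enters the other factors only as the small shift \<open>t / M ^ k\<close>.
\<close>

lemma scale_prod_split:
  assumes "M > 0"
  shows "scale_prod M A (k + m) (t + real M ^ k * of_int z) =
    scale_prod M A k t * scale_prod M A m (t / real M ^ k + of_int z)"
  using assms by (simp add: scale_prod_add scale_prod_add_multiple add_divide_distrib)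

section \<open>Digit words and their residues\<close>

text \<open>
  Words are kept apart from their values since two words may have values
  congruent modulo \<open>M ^ k\<close>, whereas exponential sums factor only over words.
\<close>

definition digits :: "int set \<Rightarrow> nat \<Rightarrow> (nat \<Rightarrow> int) set" where
  "digits A k = (\<Pi>\<^sub>E i\<in>{..<k}. A)"

definition digit_value :: "nat \<Rightarrow> nat \<Rightarrow> (nat \<Rightarrow> int) \<Rightarrow> int" where
  "digit_value M k a = (\<Sum>j<k. a j * int M ^ j)"

lemma finite_digits: "finite A \<Longrightarrow> finite (digits A k)"
  by (simp add: digits_def finite_PiE)

lemma card_digits: "card (digits A k) = card A ^ k"
  by (simp add: digits_def card_PiE)

lemma digits_eqI:
  assumes "a \<in> digits A k" "b \<in> digits A k" "\<And>j. j < k \<Longrightarrow> a j = b j"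
  shows "a = b"
  using assms unfolding digits_def by (intro PiE_ext[of a _ _ b]) auto

lemma digit_set_eq: "digit_set M A k = digit_value M k ` digits A k"
proof (intro equalityI subsetI)
  fix x assume "x \<in> digit_set M A k"
  then obtain a where a: "\<forall>j<k. a j \<in> A" "x = (\<Sum>j<k. a j * int M ^ j)"
    by (auto simp: digit_set_def)
  then have "x = digit_value M k (restrict a {..<k})" "restrict a {..<k} \<in> digits A k"
    by (auto simp: digit_value_def digits_def)
  then show "x \<in> digit_value M k ` digits A k" by blast
next
  fix x assume "x \<in> digit_value M k ` digits A k"
  then show "x \<in> digit_set M A k"
    by (auto simp: digit_set_def digit_value_def digits_def PiE_iff)
qed

lemma digit_value_Suc_left: "digit_value M (Suc k) a = a 0 + int M * digit_value M k (\<lambda>j. a (Suc j))"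
  unfolding digit_value_def by (subst sum.lessThan_Suc_shift) (simp add: sum_distrib_left mult_ac)

lemma digit_value_add: "digit_value M (k + m) a = digit_value M k a + int M ^ k * digit_value M m (\<lambda>j. a (k + j))"
  unfolding digit_value_def by (induction m) (simp_all add: power_add algebra_simps)

lemma digit_value_diff: "digit_value M k a - digit_value M k b = digit_value M k (\<lambda>j. a j - b j)"
  by (simp add: digit_value_def sum_subtractf left_diff_distrib)

lemma digit_value_inj:
  assumes "\<And>j. j < k \<Longrightarrow> a j \<in> {0..<int M}" "\<And>j. j < k \<Longrightarrow> b j \<in> {0..<int M}"
    and "digit_value M k a = digit_value M k b" "j < k"
  shows "a j = b j"
  using assms
proof (induction k arbitrary: a b j)
  case (Suc k)
  define x where "x = digit_value M k (\<lambda>j. a (Suc j))"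
  define y where "y = digit_value M k (\<lambda>j. b (Suc j))"
  have a: "a 0 \<in> {0..<int M}" and b: "b 0 \<in> {0..<int M}"
    using Suc.prems(1)[of 0] Suc.prems(2)[of 0] by simp_all
  have eq: "a 0 + int M * x = b 0 + int M * y"
    using Suc.prems(3) by (simp add: digit_value_Suc_left x_def y_def)
  have "(a 0 + int M * x) mod int M = a 0" "(b 0 + int M * y) mod int M = b 0"
    using a b by simp_all
  then have 0: "a 0 = b 0" using eq by simp
  then have xy: "x = y" using eq a by auto
  show ?case
  proof (cases j)
    case (Suc i)
    have "(\<lambda>j. a (Suc j)) i = (\<lambda>j. b (Suc j)) i"
      by (rule Suc.IH) (use Suc.prems xy Suc in \<open>auto simp: x_def y_def\<close>)
    then show ?thesis by (simp add: Suc)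
  qed (simp add: 0)
qed simp

lemma digit_value_bounds:
  assumes "\<And>j. j < k \<Longrightarrow> a j \<in> {0..<int M}"
  shows "0 \<le> digit_value M k a" "digit_value M k a < int M ^ k"
proof -
  have "0 \<le> digit_value M k a \<and> digit_value M k a < int M ^ k"
    using assms
  proof (induction k arbitrary: a)
    case 0
    then show ?case by (simp add: digit_value_def)
  next
    case (Suc k)
    have IH: "0 \<le> digit_value M k (\<lambda>j. a (Suc j))" "digit_value M k (\<lambda>j. a (Suc j)) \<le> int M ^ k - 1"
      using Suc.IH[of "\<lambda>j. a (Suc j)"] Suc.prems by auto
    have a: "0 \<le> a 0" "a 0 < int M" using Suc.prems[of 0] by auto
    have "int M * digit_value M k (\<lambda>j. a (Suc j)) \<le> int M * (int M ^ k - 1)"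
      using IH by (intro mult_left_mono) auto
    then have "digit_value M (Suc k) a < int M ^ Suc k"
      using a by (simp add: digit_value_Suc_left algebra_simps)
    then show ?case using IH a by (simp add: digit_value_Suc_left)
  qed
  then show "0 \<le> digit_value M k a" "digit_value M k a < int M ^ k" by auto
qed

lemma cis_sum: "cis (\<Sum>i\<in>I. f i) = (\<Prod>i\<in>I. cis (f i))"
  by (induction I rule: infinite_finite_induct) (simp_all add: cis_mult[symmetric])

lemma sum_digits_cis:
  assumes "finite A" "A \<noteq> {}" "M > 0"
  shows "(\<Sum>a\<in>digits A k. cis (- 2 * pi * real_of_int (digit_value M k a) * t / real (M ^ k)))
    = of_nat (card A ^ k) * scale_prod M A k t"
proof -
  have "cis (- 2 * pi * real_of_int (digit_value M k a) * t / real (M ^ k)) =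
      (\<Prod>j<k. cis (- 2 * pi * (t / real M ^ (k - j)) * real_of_int (a j)))" for a
  proof -
    have "- 2 * pi * real_of_int (digit_value M k a) * t / real (M ^ k)
        = (\<Sum>j<k. - 2 * pi * real_of_int (a j) * real M ^ j * t / real M ^ k)"
      by (simp add: digit_value_def sum_distrib_left sum_distrib_right sum_divide_distrib mult_ac)
    also have "\<dots> = (\<Sum>j<k. - 2 * pi * (t / real M ^ (k - j)) * real_of_int (a j))"
      using assms(3) by (intro sum.cong) (auto simp: power_diff)
    finally show ?thesis by (simp add: cis_sum)
  qed
  then have "(\<Sum>a\<in>digits A k. cis (- 2 * pi * real_of_int (digit_value M k a) * t / real (M ^ k)))
     = (\<Prod>j<k. \<Sum>a\<in>A. cis (- 2 * pi * (t / real M ^ (k - j)) * real_of_int a))"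
    unfolding digits_def by (simp add: prod_sum_PiE assms(1))
  also have "\<dots> = (\<Prod>j<k. of_nat (card A) * digit_ft A (t / real M ^ (k - j)))"
    using assms(1,2) by (simp add: digit_ft_eq)
  also have "\<dots> = of_nat (card A ^ k) * (\<Prod>j<k. digit_ft A (t / real M ^ (k - j)))"
    by (simp add: prod.distrib)
  also have "(\<Prod>j<k. digit_ft A (t / real M ^ (k - j))) = scale_prod M A k t"
    unfolding scale_prod_def
    by (subst prod.nat_diff_reindex[symmetric]) (auto intro!: prod.cong simp: Suc_diff_Suc)
  finally show ?thesis .
qed

lemma complex_norm_sum_square:
  "complex_of_real ((cmod (\<Sum>l\<in>Y. g l))\<^sup>2) = (\<Sum>l\<in>Y. \<Sum>l'\<in>Y. g l * cnj (g l'))"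
  unfolding complex_norm_square cnj_sum by (rule sum_product)

lemma sum_digits_norm_sq:
  fixes f :: "nat \<Rightarrow> complex"
  assumes A: "finite A" "A \<noteq> {}" and M: "M > 0"
  shows "complex_of_real (\<Sum>a\<in>digits A k. (cmod (\<Sum>l\<in>Y. cis (- 2 * pi * real_of_int (digit_value M k a) * real l / real (M ^ k)) * f l))\<^sup>2)
    = of_nat (card A ^ k) * (\<Sum>l\<in>Y. \<Sum>l'\<in>Y. f l * cnj (f l') * scale_prod M A k (real l - real l'))"
    (is "complex_of_real ?L = _")
proof -
  let ?e = "\<lambda>a l. cis (- 2 * pi * real_of_int (digit_value M k a) * l / real (M ^ k))"
  have e: "?e a (real l) * cnj (?e a (real l')) = ?e a (real l - real l')" for a l l'
    unfolding cis_cnj cis_mult by (simp add: diff_divide_distrib[symmetric] algebra_simps)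
  have "complex_of_real ?L = (\<Sum>a\<in>digits A k. \<Sum>l\<in>Y. \<Sum>l'\<in>Y. (?e a (real l) * f l) * cnj (?e a (real l') * f l'))"
    unfolding of_real_sum complex_norm_sum_square ..
  also have "\<dots> = (\<Sum>a\<in>digits A k. \<Sum>l\<in>Y. \<Sum>l'\<in>Y. f l * cnj (f l') * ?e a (real l - real l'))"
    unfolding e[symmetric] by (simp only: complex_cnj_mult mult_ac)
  also have "\<dots> = (\<Sum>l\<in>Y. \<Sum>l'\<in>Y. \<Sum>a\<in>digits A k. f l * cnj (f l') * ?e a (real l - real l'))"
    by (subst sum.swap) (intro sum.cong refl sum.swap)
  also have "\<dots> = (\<Sum>l\<in>Y. \<Sum>l'\<in>Y. f l * cnj (f l') * (of_nat (card A ^ k) * scale_prod M A k (real l - real l')))"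
    unfolding sum_distrib_left[symmetric] sum_digits_cis[OF A M] ..
  also have "\<dots> = of_nat (card A ^ k) * (\<Sum>l\<in>Y. \<Sum>l'\<in>Y. f l * cnj (f l') * scale_prod M A k (real l - real l'))"
    by (simp only: sum_distrib_left mult_ac)
  finally show ?thesis .
qed

abbreviation residue :: "nat \<Rightarrow> int \<Rightarrow> nat" where
  "residue N x \<equiv> nat (x mod int N)"

lemma residue_eq:
  assumes "N > 0"
  shows "real (residue N x) = real_of_int x + real N * of_int (- (x div int N))"
proof -
  have "int (residue N x) = x - int N * (x div int N)"
    using assms by (simp add: minus_mult_div_eq_mod)
  then have "real_of_int (int (residue N x)) = real_of_int (x - int N * (x div int N))"
    by (rule arg_cong)
  then show ?thesis
    unfolding of_int_of_nat_eq by simp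
qed

lemma residues_subset: "N > 0 \<Longrightarrow> residues_of N S \<subseteq> {..<N}"
  by (auto simp: residues_of_def nat_less_iff)

lemma residues_of_digit_set:
  "residues_of N (digit_set M A k) = (\<lambda>a. residue N (digit_value M k a)) ` digits A k"
  by (simp add: residues_of_def digit_set_eq image_image)

lemma cis_residue:
  assumes "N > 0"
  shows "cis (- 2 * pi * real (residue N x) * real_of_int l / real N) = cis (- 2 * pi * real_of_int x * real_of_int l / real N)"
proof -
  have "- 2 * pi * real (residue N x) * real_of_int l / real N
     = - 2 * pi * real_of_int x * real_of_int l / real N + 2 * pi * of_int (x div int N * l)"
    unfolding residue_eq[OF assms] using assms by (simp add: field_simps)
  then show ?thesis by (simp only: cis_add_int_period)
qed

lemma scale_prod_residue_diff:
  assumes "M > 0"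
  shows "scale_prod M A k (real (residue (M ^ k) x) - real (residue (M ^ k) y)) =
    scale_prod M A k (real_of_int (x - y))"
proof -
  have N: "M ^ k > 0" using assms by simp
  have "real (residue (M ^ k) x) - real (residue (M ^ k) y)
     = real_of_int (x - y) + real M ^ k * of_int (y div int (M ^ k) - x div int (M ^ k))"
    unfolding residue_eq[OF N] by (simp add: algebra_simps)
  then show ?thesis by (simp only: scale_prod_add_multiple[OF assms])
qed

lemma residue_digit_value_inj:
  assumes A: "A \<subseteq> {0..int M - 1}"
  shows "inj_on (\<lambda>a. residue (M ^ k) (digit_value M k a)) (digits A k)"
proof (rule inj_onI)
  fix a b assume ab: "a \<in> digits A k" "b \<in> digits A k"
    and eq: "residue (M ^ k) (digit_value M k a) = residue (M ^ k) (digit_value M k b)"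
  have dig: "c j \<in> {0..<int M}" if "c \<in> digits A k" "j < k" for c j
    using that A by (fastforce simp: digits_def PiE_iff)
  have res: "residue (M ^ k) (digit_value M k c) = nat (digit_value M k c)" if "c \<in> digits A k" for c
    using digit_value_bounds[of k c M] dig[OF that] by simp
  have "digit_value M k a = digit_value M k b"
    using eq digit_value_bounds[of k a M] digit_value_bounds[of k b M] dig ab by (simp add: res eq_nat_nat_iff)
  then have "a j = b j" if "j < k" for j
    using digit_value_inj[of k a M b j] dig ab that by blast
  then show "a = b" by (rule digits_eqI[OF ab])
qed

lemma uncertainty_norm_eq:
  "uncertainty_norm M A B k = l2_op_norm (localized_dft (M ^ k)
     (residues_of (M ^ k) (digit_set M A k)) (residues_of (M ^ k) (digit_set M B k)))"
  by (simp add: uncertainty_norm_def localized_dft_def)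

lemma uncertainty_norm_nonneg: "M > 0 \<Longrightarrow> 0 \<le> uncertainty_norm M A B k"
  unfolding uncertainty_norm_eq by (intro l2_op_norm_localized_nonneg residues_subset) auto

section \<open>Norm bounds for distributed spectral pairs\<close>

text \<open>
  Let \<open>i\<close> be the first position at which the words differ. Modulo integers the quotients of the difference of
  the values by \<open>M ^ (i + 1)\<close> and \<open>M ^ (i + 2)\<close> depend only on the digits \<open>i\<close> and \<open>i + 1\<close>, and the definition of a
  distributed spectral pair makes \<open>digit_ft\<close> vanish at one of them. The last position is excluded because
  the second quotient then belongs to no factor.
\<close>

lemma distributed_scale_prod_zero:
  assumes dist: "distributed_spectral_pair M A B" and M: "M > 0"
    and b: "b \<in> digits B k" and b': "b' \<in> digits B k"
    and j: "Suc j < k" "b j \<noteq> b' j"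
  shows "scale_prod M A k (real_of_int (digit_value M k b - digit_value M k b')) = 0"
proof -
  define i where "i = (LEAST j. b j \<noteq> b' j)"
  have i: "b i \<noteq> b' i" unfolding i_def by (rule LeastI) (rule j)
  have "i \<le> j" unfolding i_def by (rule Least_le) (rule j)
  then have ik: "Suc i < k" using j by simp
  have low: "b m = b' m" if "m < i" for m
    using not_less_Least[of m "\<lambda>j. b j \<noteq> b' j"] that unfolding i_def by blast
  define d where "d = (\<lambda>m. b m - b' m)"
  obtain m where k: "k = i + Suc (Suc m)" using less_imp_Suc_add[OF ik] by auto
  define z where "z = digit_value M m (\<lambda>m. d (i + Suc (Suc m)))"
  have "digit_value M k b - digit_value M k b' = digit_value M k d"
    by (simp add: digit_value_diff d_def)
  also have "\<dots> = digit_value M i d + int M ^ i * (d i + int M * (d (Suc i) + int M * z))"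
    unfolding k digit_value_add digit_value_Suc_left z_def by simp
  also have "digit_value M i d = 0"
    by (simp add: digit_value_def d_def low)
  finally have D: "digit_value M k b - digit_value M k b' = int M ^ i * (d i + int M * (d (Suc i) + int M * z))"
    by simp
  define D where "D = real_of_int (digit_value M k b - digit_value M k b')"
  have D': "D = real M ^ i * (real_of_int (d i) + real M * (of_int (d (Suc i)) + real M * of_int z))"
    unfolding D_def D by simp
  have 1: "digit_ft A (D / real M ^ Suc i) = digit_ft A (real_of_int (b i - b' i) / real M)"
  proof -
    have "D / real M ^ Suc i = real_of_int (b i - b' i) / real M + of_int (d (Suc i) + int M * z)"
      unfolding D' using M by (simp add: field_simps d_def)
    then show ?thesis by (simp only: digit_ft_add_int)
  qed
  have 2: "digit_ft A (D / real M ^ Suc (Suc i)) =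
      digit_ft A (real_of_int (b i - b' i) / real M ^ 2 + real_of_int (b (Suc i) - b' (Suc i)) / real M)"
  proof -
    have "D / real M ^ Suc (Suc i) = real_of_int (b i - b' i) / real M ^ 2
        + real_of_int (b (Suc i) - b' (Suc i)) / real M + of_int z"
      unfolding D' using M by (simp add: field_simps d_def power2_eq_square)
    then show ?thesis by (simp only: digit_ft_add_int)
  qed
  have mem: "b i \<in> B" "b' i \<in> B" "b (Suc i) \<in> B" "b' (Suc i) \<in> B"
    using b b' ik by (auto simp: digits_def PiE_iff)
  then have "digit_ft A (D / real M ^ Suc i) = 0 \<or> digit_ft A (D / real M ^ Suc (Suc i)) = 0"
    unfolding 1 2 using dist i unfolding distributed_spectral_pair_def by blast
  then have "\<exists>s\<in>{..<k}. digit_ft A (D / real M ^ Suc s) = 0"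
    using ik Suc_lessD by blast
  then show ?thesis
    unfolding scale_prod_def D_def[symmetric] by (simp only: prod_zero_iff[OF finite_lessThan])
qed

text \<open>
  Schur's test for a kernel with few nonzero entries, from \<open>2 x y \<le> x\<^sup>2 + y\<^sup>2\<close> on each of them.
\<close>

lemma sparse_form_bound:
  fixes H :: "'a \<Rightarrow> 'a \<Rightarrow> complex"
  assumes Y: "finite Y" and H: "\<And>l l'. cmod (H l l') \<le> 1"
    and row: "\<And>l. l \<in> Y \<Longrightarrow> card {l' \<in> Y. H l l' \<noteq> 0} \<le> n"
    and col: "\<And>l'. l' \<in> Y \<Longrightarrow> card {l \<in> Y. H l l' \<noteq> 0} \<le> n"
  shows "cmod (\<Sum>l\<in>Y. \<Sum>l'\<in>Y. f l * cnj (f l') * H l l') \<le> real n * (\<Sum>l\<in>Y. (cmod (f l))\<^sup>2)"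
proof -
  define E where "E l l' = (if H l l' \<noteq> 0 then 1 else 0 :: real)" for l l'
  have "cmod (\<Sum>l\<in>Y. \<Sum>l'\<in>Y. f l * cnj (f l') * H l l')
      \<le> (\<Sum>l\<in>Y. \<Sum>l'\<in>Y. cmod (f l * cnj (f l') * H l l'))"
    by (intro order_trans[OF norm_sum] sum_mono norm_sum)
  also have "\<dots> \<le> (\<Sum>l\<in>Y. \<Sum>l'\<in>Y. (cmod (f l))\<^sup>2 / 2 * E l l' + (cmod (f l'))\<^sup>2 / 2 * E l l')"
  proof (intro sum_mono)
    fix l l'
    have "cmod (f l * cnj (f l') * H l l') \<le> cmod (f l) * cmod (f l') * E l l'"
      using H[of l l'] by (auto simp: norm_mult E_def intro: mult_left_le)
    also have "\<dots> \<le> ((cmod (f l))\<^sup>2 / 2 + (cmod (f l'))\<^sup>2 / 2) * E l l'"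
      using sum_squares_bound[of "cmod (f l)" "cmod (f l')"] by (intro mult_right_mono) (auto simp: E_def)
    finally show "cmod (f l * cnj (f l') * H l l') \<le> (cmod (f l))\<^sup>2 / 2 * E l l' + (cmod (f l'))\<^sup>2 / 2 * E l l'"
      by (simp add: distrib_right)
  qed
  also have "\<dots> = (\<Sum>l\<in>Y. (cmod (f l))\<^sup>2 / 2 * (\<Sum>l'\<in>Y. E l l')) + (\<Sum>l'\<in>Y. (cmod (f l'))\<^sup>2 / 2 * (\<Sum>l\<in>Y. E l l'))"
    unfolding sum.distrib sum_distrib_left by (subst (2) sum.swap) (rule refl)
  also have "\<dots> \<le> (\<Sum>l\<in>Y. (cmod (f l))\<^sup>2 / 2 * real n) + (\<Sum>l'\<in>Y. (cmod (f l'))\<^sup>2 / 2 * real n)"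
  proof (intro add_mono sum_mono mult_left_mono)
    fix l assume l: "l \<in> Y"
    have "(\<Sum>l'\<in>Y. E l l') = real (card {l' \<in> Y. H l l' \<noteq> 0})"
      using Y by (simp add: E_def sum.If_cases Int_def)
    then show "(\<Sum>l'\<in>Y. E l l') \<le> real n" using row[OF l] by simp
    have "(\<Sum>l'\<in>Y. E l' l) = real (card {l' \<in> Y. H l' l \<noteq> 0})"
      using Y by (simp add: E_def sum.If_cases Int_def)
    then show "(\<Sum>l'\<in>Y. E l' l) \<le> real n" using col[OF l] by simp
  qed auto
  also have "\<dots> = real n * (\<Sum>l\<in>Y. (cmod (f l))\<^sup>2)"
    by (simp add: sum_distrib_left[symmetric] sum_distrib_right[symmetric] sum_divide_distrib[symmetric])
  finally show ?thesis .
qed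

text \<open>
  By \<open>distributed_scale_prod_zero\<close> a nonzero entry forces agreement of all digits but the last, so
  that only the choice of the last digit is left.
\<close>

lemma distributed_row_sparse:
  assumes dist: "distributed_spectral_pair M A B" and M: "M > 0" and B: "finite B"
    and Y: "Y = residues_of (M ^ Suc k) (digit_set M B (Suc k))" and l: "l \<in> Y"
  shows "card {l' \<in> Y. scale_prod M A (Suc k) (real l - real l') \<noteq> 0} \<le> card B"
proof -
  obtain b where b: "b \<in> digits B (Suc k)" "l = residue (M ^ Suc k) (digit_value M (Suc k) b)"
    using l unfolding Y residues_of_digit_set by blast
  have "{l' \<in> Y. scale_prod M A (Suc k) (real l - real l') \<noteq> 0}
      \<subseteq> (\<lambda>c. residue (M ^ Suc k) (digit_value M k b + c * int M ^ k)) ` B"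
  proof
    fix l' assume "l' \<in> {l' \<in> Y. scale_prod M A (Suc k) (real l - real l') \<noteq> 0}"
    then obtain b' where b': "b' \<in> digits B (Suc k)" "l' = residue (M ^ Suc k) (digit_value M (Suc k) b')"
        and nz: "scale_prod M A (Suc k) (real l - real l') \<noteq> 0"
      unfolding Y residues_of_digit_set by blast
    have "scale_prod M A (Suc k) (real_of_int (digit_value M (Suc k) b - digit_value M (Suc k) b')) \<noteq> 0"
      using nz unfolding b(2) b'(2) scale_prod_residue_diff[OF M] .
    then have "b j = b' j" if "j < k" for j
      using distributed_scale_prod_zero[OF dist M b(1) b'(1), of j] that by auto
    then have "digit_value M k b' = digit_value M k b"
      by (simp add: digit_value_def)
    then have "l' = residue (M ^ Suc k) (digit_value M k b + b' k * int M ^ k)"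
      using b'(2) by (simp add: digit_value_def)
    moreover have "b' k \<in> B" using b'(1) by (auto simp: digits_def PiE_iff)
    ultimately show "l' \<in> (\<lambda>c. residue (M ^ Suc k) (digit_value M k b + c * int M ^ k)) ` B"
      by blast
  qed
  then have "card {l' \<in> Y. scale_prod M A (Suc k) (real l - real l') \<noteq> 0}
      \<le> card ((\<lambda>c. residue (M ^ Suc k) (digit_value M k b + c * int M ^ k)) ` B)"
    by (intro card_mono) (simp_all add: B)
  also have "\<dots> \<le> card B" by (rule card_image_le[OF B])
  finally show ?thesis .
qed

text \<open>
  Summing over digit words instead of residues only increases the sum over the rows, as every
  residue has a word; and the sum over words is the quadratic form of the sparse kernel.
\<close>

lemma distributed_uncertainty_norm_le:
  assumes dist: "distributed_spectral_pair M A B" and M: "M > 0"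
    and A: "finite A" "A \<noteq> {}" and B: "finite B" and card: "card A = card B"
  shows "uncertainty_norm M A B (Suc k) \<le> sqrt (real (card A) ^ Suc (Suc k) / real M ^ Suc k)"
proof -
  define N where "N = M ^ Suc k"
  define X where "X = residues_of N (digit_set M A (Suc k))"
  define Y where "Y = residues_of N (digit_set M B (Suc k))"
  define c where "c = sqrt (real (card A) ^ Suc (Suc k) / real M ^ Suc k)"
  have N: "N > 0" using M by (simp add: N_def)
  have XY: "X \<subseteq> {..<N}" "Y \<subseteq> {..<N}" using N by (simp_all add: X_def Y_def residues_subset)
  have finY: "finite Y" using XY finite_subset by blast
  have c: "0 \<le> c" by (simp add: c_def)
  have cN: "c\<^sup>2 * real N = real (card A) ^ Suc (Suc k)"
    using M by (simp add: c_def N_def)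
  have "(\<Sum>j\<in>X. (cmod (\<Sum>l\<in>Y. cis (- 2 * pi * real j * real l / real N) * f l))\<^sup>2)
      \<le> c\<^sup>2 * real N * (\<Sum>l\<in>Y. (cmod (f l))\<^sup>2)" for f
  proof -
    define g where "g j = (cmod (\<Sum>l\<in>Y. cis (- 2 * pi * real j * real l / real N) * f l))\<^sup>2" for j :: nat
    define S where "S = (\<Sum>a\<in>digits A (Suc k). (cmod (\<Sum>l\<in>Y. cis (- 2 * pi * real_of_int (digit_value M (Suc k) a) * real l / real N) * f l))\<^sup>2)"
    have "(\<Sum>j\<in>X. g j) \<le> (\<Sum>a\<in>digits A (Suc k). g (residue N (digit_value M (Suc k) a)))"
      unfolding X_def residues_of_digit_set
      by (rule sum_image_le[unfolded o_def]) (simp_all add: finite_digits A g_def)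
    also have "\<dots> = S"
      unfolding S_def g_def using cis_residue[OF N, of _ "int _"] by simp
    finally have le: "(\<Sum>j\<in>X. g j) \<le> S" .
    have "0 \<le> S" unfolding S_def by (intro sum_nonneg) simp
    then have "S = cmod (complex_of_real S)" by simp
    also have "\<dots> = real (card A) ^ Suc k * cmod (\<Sum>l\<in>Y. \<Sum>l'\<in>Y. f l * cnj (f l') * scale_prod M A (Suc k) (real l - real l'))"
      unfolding S_def N_def sum_digits_norm_sq[OF A M] norm_mult norm_of_nat by simp
    also have "\<dots> \<le> real (card A) ^ Suc k * (real (card B) * (\<Sum>l\<in>Y. (cmod (f l))\<^sup>2))"
    proof (intro mult_left_mono sparse_form_bound finY)
      show "cmod (scale_prod M A (Suc k) (real l - real l')) \<le> 1" for l l'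
        by (rule cmod_scale_prod_le_1)
      show row: "card {l' \<in> Y. scale_prod M A (Suc k) (real l - real l') \<noteq> 0} \<le> card B" if "l \<in> Y" for l
        using distributed_row_sparse[OF dist M B _ that] by (simp add: Y_def N_def)
      have sym: "scale_prod M A (Suc k) (real l - real l') \<noteq> 0 \<longleftrightarrow> scale_prod M A (Suc k) (real l' - real l) \<noteq> 0" for l l'
        using scale_prod_uminus[of M A "Suc k" "real l - real l'"] by simp
      show "card {l \<in> Y. scale_prod M A (Suc k) (real l - real l') \<noteq> 0} \<le> card B" if "l' \<in> Y" for l'
        using row[OF that] unfolding sym[of l'] .
    qed simp
    also have "\<dots> = c\<^sup>2 * real N * (\<Sum>l\<in>Y. (cmod (f l))\<^sup>2)"
      unfolding cN by (simp add: card)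
    finally show ?thesis using le by (simp add: g_def)
  qed
  then have "l2_op_norm (localized_dft N X Y) \<le> c"
    by (intro localized_dft_op_norm_le[OF XY N c])
  then show ?thesis by (simp add: uncertainty_norm_eq c_def X_def Y_def N_def)
qed

text \<open>
  Fix the last digit. Words with equal residues have a difference that is a period of \<open>scale_prod\<close>,
  where its value is 1, not 0; so they agree in all digits but the last, which is fixed.
\<close>

lemma distributed_card_residues_ge:
  assumes dist: "distributed_spectral_pair M A B" and M: "M > 0"
    and A: "finite A" "A \<noteq> {}" and B: "finite B" "B \<noteq> {}"
  shows "card B ^ k \<le> card (residues_of (M ^ Suc k) (digit_set M B (Suc k)))"
proof -
  obtain c where c: "c \<in> B" using B by blast
  define \<phi> where "\<phi> b = residue (M ^ Suc k) (digit_value M (Suc k) (b(k := c)))" for b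
  have upd: "b(k := c) \<in> digits B (Suc k)" if "b \<in> digits B k" for b
    using that c by (auto simp: digits_def PiE_iff extensional_def less_Suc_eq)
  have "inj_on \<phi> (digits B k)"
  proof (rule inj_onI)
    fix b b' assume b: "b \<in> digits B k" "b' \<in> digits B k" "\<phi> b = \<phi> b'"
    have "scale_prod M A (Suc k) (real (\<phi> b) - real (\<phi> b')) \<noteq> 0"
      using b(3) by (simp add: scale_prod_0 A)
    then have nz: "scale_prod M A (Suc k) (real_of_int (digit_value M (Suc k) (b(k := c)) - digit_value M (Suc k) (b'(k := c)))) \<noteq> 0"
      unfolding \<phi>_def scale_prod_residue_diff[OF M] .
    show "b = b'"
    proof (rule digits_eqI[OF b(1,2)], rule ccontr)
      fix j assume that: "j < k"
      assume "b j \<noteq> b' j"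
      then have "(b(k := c)) j \<noteq> (b'(k := c)) j" using that by simp
      then show False
        using nz distributed_scale_prod_zero[OF dist M upd[OF b(1)] upd[OF b(2)], of j] that by simp
    qed
  qed
  then have "card B ^ k = card (\<phi> ` digits B k)"
    by (simp add: card_image card_digits)
  also have "\<dots> \<le> card (residues_of (M ^ Suc k) (digit_set M B (Suc k)))"
    unfolding residues_of_digit_set \<phi>_def
    by (intro card_mono finite_imageI finite_digits B) (use upd in blast)
  finally show ?thesis .
qed

text \<open>
  The norm is at least that of a single row, whose entries in the columns of the residues all have
  modulus \<open>M powr (- k / 2)\<close>.
\<close>

lemma uncertainty_norm_sq_ge_card:
  assumes M: "M > 0" and A: "A \<noteq> {}"
  shows "real (card (residues_of (M ^ k) (digit_set M B k))) / real M ^ k \<le> (uncertainty_norm M A B k)\<^sup>2"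
proof -
  define N where "N = M ^ k"
  define X where "X = residues_of N (digit_set M A k)"
  define Y where "Y = residues_of N (digit_set M B k)"
  have N: "N > 0" using M by (simp add: N_def)
  have XY: "X \<subseteq> {..<N}" "Y \<subseteq> {..<N}" using N by (simp_all add: X_def Y_def residues_subset)
  have finX: "finite X" using XY finite_subset by blast
  have "digits A k \<noteq> {}" using A by (simp add: digits_def PiE_eq_empty_iff)
  then obtain i where i: "i \<in> X" unfolding X_def residues_of_digit_set by blast
  \<comment> \<open>The adjoint maps the unit vector at \<open>i\<close> to the conjugate of the row \<open>i\<close>.\<close>
  define g :: "nat \<Rightarrow> complex" where "g j = (if j = i then 1 else 0)" for j
  have 1: "(\<Sum>j\<in>X. cis (2 * pi * real j * real l / real N) * g j) = cis (2 * pi * real i * real l / real N)" for l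
  proof -
    have "(\<Sum>j\<in>X. cis (2 * pi * real j * real l / real N) * g j)
        = (\<Sum>j\<in>X. if j = i then cis (2 * pi * real j * real l / real N) else 0)"
      by (intro sum.cong) (auto simp: g_def)
    then show ?thesis using finX i by simp
  qed
  have 2: "(\<Sum>j\<in>X. (cmod (g j))\<^sup>2) = 1"
  proof -
    have "(\<Sum>j\<in>X. (cmod (g j))\<^sup>2) = (\<Sum>j\<in>X. if j = i then 1 else 0)"
      by (intro sum.cong) (auto simp: g_def)
    then show ?thesis using finX i by simp
  qed
  have "real (card Y) \<le> (l2_op_norm (localized_dft N X Y))\<^sup>2 * real N"
    using localized_dft_adjoint_le[OF XY N, of g] unfolding 1 2 by simp
  then show ?thesis
    using N by (simp add: uncertainty_norm_eq X_def Y_def N_def pos_divide_le_eq)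
qed

section \<open>Lipschitz bounds\<close>

lemma cmod_cis_diff_le: "cmod (cis x - cis y) \<le> \<bar>x - y\<bar>"
proof (rule power2_le_imp_le)
  have "(cmod (cis x - cis y))\<^sup>2 = (cos x)\<^sup>2 + (sin x)\<^sup>2 + ((cos y)\<^sup>2 + (sin y)\<^sup>2) - 2 * (cos x * cos y + sin x * sin y)"
    by (simp add: cmod_power2 power2_diff del: sin_cos_squared_add sin_cos_squared_add2)
  also have "\<dots> = 2 - 2 * cos (x - y)"
    by (simp add: cos_diff)
  also have "\<dots> = 4 * (sin ((x - y) / 2))\<^sup>2"
    using cos_double_sin[of "(x - y) / 2"] by (simp only: nonzero_mult_div_cancel_left times_divide_eq_right) simp
  also have "\<dots> \<le> 4 * ((x - y) / 2)\<^sup>2"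
    using abs_sin_x_le_abs_x[of "(x - y) / 2"] by (intro mult_left_mono abs_le_square_iff[THEN iffD1]) simp_all
  also have "\<dots> = \<bar>x - y\<bar>\<^sup>2" by (simp add: power_divide)
  finally show "(cmod (cis x - cis y))\<^sup>2 \<le> \<bar>x - y\<bar>\<^sup>2" .
qed simp

lemma digit_ft_lipschitz:
  assumes A: "A \<subseteq> {0..int M - 1}"
  shows "cmod (digit_ft A \<xi> - digit_ft A \<eta>) \<le> 2 * pi * real M * \<bar>\<xi> - \<eta>\<bar>"
proof -
  have term_le: "cmod (cis (- 2 * pi * \<xi> * of_int a) - cis (- 2 * pi * \<eta> * of_int a)) \<le> 2 * pi * real M * \<bar>\<xi> - \<eta>\<bar>"
    if "a \<in> A" for a
  proof -
    have a: "0 \<le> a" "a \<le> int M" using A that by auto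
    have "\<bar>- 2 * pi * \<xi> * of_int a - - 2 * pi * \<eta> * of_int a\<bar> = \<bar>(2 * pi * of_int a) * (\<xi> - \<eta>)\<bar>"
      by (simp add: algebra_simps abs_minus_commute)
    also have "\<dots> = 2 * pi * of_int a * \<bar>\<xi> - \<eta>\<bar>"
      using a by (simp add: abs_mult)
    also have "\<dots> \<le> 2 * pi * real M * \<bar>\<xi> - \<eta>\<bar>"
      using a by (intro mult_right_mono mult_left_mono) auto
    finally show ?thesis by (rule order_trans[OF cmod_cis_diff_le])
  qed
  have "cmod (digit_ft A \<xi> - digit_ft A \<eta>)
      = cmod (\<Sum>a\<in>A. cis (- 2 * pi * \<xi> * of_int a) - cis (- 2 * pi * \<eta> * of_int a)) / real (card A)"
    by (simp add: digit_ft_eq sum_subtractf diff_divide_distrib[symmetric] norm_divide)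
  also have "\<dots> \<le> (\<Sum>a\<in>A. 2 * pi * real M * \<bar>\<xi> - \<eta>\<bar>) / real (card A)"
    by (intro divide_right_mono order_trans[OF norm_sum] sum_mono term_le) auto
  also have "\<dots> \<le> 2 * pi * real M * \<bar>\<xi> - \<eta>\<bar>"
    by (cases "card A = 0") simp_all
  finally show ?thesis .
qed

lemma sum_inverse_powers_le_1:
  assumes "M \<ge> 2"
  shows "(\<Sum>s<k. 1 / real M ^ Suc s) \<le> 1"
proof -
  have "(\<Sum>s<k. 1 / real M ^ Suc s) \<le> (\<Sum>s<k. (1 / 2) ^ Suc s)"
  proof (rule sum_mono)
    fix s
    have "(2::real) ^ Suc s \<le> real M ^ Suc s" using assms by (intro power_mono) auto
    then show "1 / real M ^ Suc s \<le> (1 / 2) ^ Suc s"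
      by (simp only: power_one_over) (intro divide_left_mono; use assms in simp)
  qed
  also have "\<dots> = 1 - (1 / 2) ^ k" by (induction k) simp_all
  finally show ?thesis by (simp add: order_trans)
qed

text \<open>
  The constant does not depend on \<open>k\<close>: the factors are bounded by 1, and their Lipschitz constants decay
  geometrically.
\<close>

lemma scale_prod_lipschitz:
  assumes A: "A \<subseteq> {0..int M - 1}" and M: "M \<ge> 2"
  shows "cmod (scale_prod M A k x - scale_prod M A k y) \<le> 2 * pi * real M * \<bar>x - y\<bar>"
proof -
  have "cmod (scale_prod M A k x - scale_prod M A k y)
      \<le> (\<Sum>s<k. cmod (digit_ft A (x / real M ^ Suc s) - digit_ft A (y / real M ^ Suc s)))"
    unfolding scale_prod_def by (intro norm_prod_diff cmod_digit_ft_le_1)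
  also have "\<dots> \<le> (\<Sum>s<k. 2 * pi * real M * \<bar>x - y\<bar> * (1 / real M ^ Suc s))"
  proof (rule sum_mono)
    fix s
    have "\<bar>x / real M ^ Suc s - y / real M ^ Suc s\<bar> = \<bar>x - y\<bar> * (1 / real M ^ Suc s)"
      by (simp add: diff_divide_distrib[symmetric])
    then show "cmod (digit_ft A (x / real M ^ Suc s) - digit_ft A (y / real M ^ Suc s))
        \<le> 2 * pi * real M * \<bar>x - y\<bar> * (1 / real M ^ Suc s)"
      using digit_ft_lipschitz[OF A, of "x / real M ^ Suc s" "y / real M ^ Suc s"] by (simp only: mult_ac)
  qed
  also have "\<dots> = 2 * pi * real M * \<bar>x - y\<bar> * (\<Sum>s<k. 1 / real M ^ Suc s)"
    by (rule sum_distrib_left[symmetric])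
  also have "\<dots> \<le> 2 * pi * real M * \<bar>x - y\<bar> * 1"
    using M by (intro mult_left_mono sum_inverse_powers_le_1) auto
  finally show ?thesis by simp
qed

section \<open>Zeros of the Fourier transform near the origin\<close>

lemma mult_tan_strict_mono:
  fixes v w :: real
  assumes "pi / 2 < v" "v < w" "w < pi"
  shows "v * tan v < w * tan w"
proof (rule DERIV_pos_imp_increasing[OF assms(2)])
  fix u assume u: "v \<le> u" "u \<le> w"
  have cu: "cos u < 0"
    using cos_monotone_0_pi[of "pi / 2" u] u assms by simp
  have su: "0 < sin u" using u assms pi_gt_zero by (intro sin_gt_zero) linarith+
  have "((\<lambda>u. u * tan u) has_real_derivative (1 * tan u + inverse ((cos u)\<^sup>2) * u)) (at u)"
    using cu by (intro DERIV_mult DERIV_ident DERIV_tan) simp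
  moreover have "1 * tan u + inverse ((cos u)\<^sup>2) * u = (u + sin u * cos u) / (cos u)\<^sup>2"
    using cu by (simp add: tan_def field_simps power2_eq_square)
  moreover have "0 < (u + sin u * cos u) / (cos u)\<^sup>2"
  proof (intro divide_pos_pos)
    \<comment> \<open>\<open>u\<close> exceeds \<open>\<pi> / 2 \<ge> 1\<close>, which is at least \<open>|sin u cos u|\<close>.\<close>
    have "\<bar>sin u * cos u\<bar> \<le> 1 * 1"
      unfolding abs_mult by (intro mult_mono) auto
    moreover have "1 < u" using u assms pi_ge_two by linarith
    ultimately show "0 < u + sin u * cos u" by linarith
  qed (use cu in simp)
  ultimately show "\<exists>y. ((\<lambda>u. u * tan u) has_real_derivative y) (at u) \<and> 0 < y"
    by auto
qed

text \<open>
  The sign of the derivative is that of \<open>w tan w - v tan v\<close> with \<open>v = p s\<close> and \<open>w = q s\<close>, both in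
  \<open>(\<pi>/2, \<pi>)\<close>.
\<close>

lemma cos_ratio_strict_mono:
  fixes p q \<tau> T :: real
  assumes p: "0 < p" "p < q" and t: "\<tau> < T" and lo: "pi / 2 < p * \<tau>" and hi: "q * T < pi"
  shows "cos (p * \<tau>) / cos (q * \<tau>) < cos (p * T) / cos (q * T)"
proof (rule DERIV_pos_imp_increasing[OF t])
  fix s assume s: "\<tau> \<le> s" "s \<le> T"
  have s0: "0 < s"
  proof -
    have "0 < p * \<tau>" using lo pi_gt_zero by linarith
    then have "0 < \<tau>" using p by (simp add: zero_less_mult_iff)
    then show ?thesis using s by simp
  qed
  have v: "pi / 2 < p * s" using lo mult_left_mono[of \<tau> s p] s p by linarith
  have vw: "p * s < q * s" using p s0 by simp
  have w: "q * s < pi" using hi mult_left_mono[of s T q] s p by linarith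
  have cv: "cos (p * s) < 0" using cos_monotone_0_pi[of "pi / 2" "p * s"] v vw w by simp
  have cw: "cos (q * s) < 0" using cos_monotone_0_pi[of "pi / 2" "q * s"] v vw w by simp
  have "((\<lambda>s. cos (p * s) / cos (q * s)) has_real_derivative
      ((- sin (p * s) * p) * cos (q * s) - cos (p * s) * (- sin (q * s) * q)) / (cos (q * s) * cos (q * s))) (at s)"
    using cw by (auto intro!: derivative_eq_intros)
  moreover have "0 < ((- sin (p * s) * p) * cos (q * s) - cos (p * s) * (- sin (q * s) * q)) / (cos (q * s) * cos (q * s))"
  proof (intro divide_pos_pos mult_neg_neg cw)
    have "p * s * tan (p * s) < q * s * tan (q * s)"
      by (rule mult_tan_strict_mono[OF v vw w])
    then have "s * (p * tan (p * s)) < s * (q * tan (q * s))" by (simp add: mult_ac)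
    then have "p * tan (p * s) < q * tan (q * s)" using s0 by simp
    then have "(p * tan (p * s)) * (cos (p * s) * cos (q * s)) < (q * tan (q * s)) * (cos (p * s) * cos (q * s))"
      using cv cw by (intro mult_strict_right_mono mult_neg_neg)
    moreover have "(p * tan (p * s)) * (cos (p * s) * cos (q * s)) = p * sin (p * s) * cos (q * s)"
      using cv by (simp add: tan_def)
    moreover have "(q * tan (q * s)) * (cos (p * s) * cos (q * s)) = q * sin (q * s) * cos (p * s)"
      using cw by (simp add: tan_def)
    ultimately show "0 < (- sin (p * s) * p) * cos (q * s) - cos (p * s) * (- sin (q * s) * q)"
      by (simp only: mult_minus_left mult_minus_right diff_minus_eq_add mult_ac)
  qed
  ultimately show "\<exists>y. ((\<lambda>s. cos (p * s) / cos (q * s)) has_real_derivative y) (at s) \<and> 0 < y"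
    by blast
qed

text \<open>
  The combination vanishes at \<open>\<tau> = T\<close> by its choice, and it is positive before. The only delicate range
  is the one where both \<open>p \<tau>\<close> and \<open>q \<tau>\<close> exceed \<open>\<pi>/2\<close>; there the inequality compares ratios of cosines.
\<close>

lemma cos_combination_pos:
  fixes p q \<tau> T :: real
  assumes p: "0 < p" "p < q" and t: "0 \<le> \<tau>" "\<tau> < T" and lo: "pi / 2 < p * T" and hi: "q * T < pi"
  shows "cos (p * T) * cos (q * \<tau>) - cos (q * T) * cos (p * \<tau>) > 0"
proof -
  have pq: "p * T < q * T" using p t by simp
  have cp: "cos (p * T) < 0" using cos_monotone_0_pi[of "pi / 2" "p * T"] lo pq hi by simp
  have cqp: "cos (q * T) < cos (p * T)" using cos_monotone_0_pi[of "p * T" "q * T"] lo pq hi pi_gt_zero by simp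
  have le: "p * \<tau> \<le> q * \<tau>" using p t by (simp add: mult_right_mono)
  have qt: "q * \<tau> < q * T" using p t by simp
  have pt0: "0 \<le> p * \<tau>" using p t by simp
  consider "q * \<tau> \<le> pi / 2" | "p * \<tau> \<le> pi / 2" "pi / 2 < q * \<tau>" | "pi / 2 < p * \<tau>" by linarith
  then show ?thesis
  proof cases
    case 1
    have cq: "0 \<le> cos (q * \<tau>)" using 1 pt0 le by (intro cos_ge_zero) linarith+
    have cc: "cos (q * \<tau>) \<le> cos (p * \<tau>)" using cos_monotone_0_pi_le[OF pt0 le] 1 pi_gt_zero by linarith
    have pos: "0 < cos (p * \<tau>)"
    proof (cases "\<tau> = 0")
      case False
      then have "p * \<tau> < q * \<tau>" using p t by simp
      then show ?thesis using 1 pt0 by (intro cos_gt_zero_pi) linarith+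
    qed simp
    have "(- cos (p * T)) * cos (q * \<tau>) \<le> (- cos (p * T)) * cos (p * \<tau>)"
      using cp cc by (intro mult_left_mono) auto
    also have "\<dots> < (- cos (q * T)) * cos (p * \<tau>)"
      using cqp pos by (intro mult_strict_right_mono) auto
    finally show ?thesis by simp
  next
    case 2
    have "cos (q * \<tau>) < 0" using cos_monotone_0_pi[of "pi / 2" "q * \<tau>"] 2 qt hi by simp
    then have "0 < cos (p * T) * cos (q * \<tau>)" using cp by (intro mult_neg_neg)
    moreover have "0 \<le> (- cos (q * T)) * cos (p * \<tau>)"
      using cp cqp 2 pt0 by (intro mult_nonneg_nonneg cos_ge_zero) linarith+
    ultimately show ?thesis by simp
  next
    case 3
    have cq: "cos (q * \<tau>) < 0" using cos_monotone_0_pi[of "pi / 2" "q * \<tau>"] 3 le qt hi by simp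
    have "cos (p * \<tau>) / cos (q * \<tau>) < cos (p * T) / cos (q * T)"
      by (rule cos_ratio_strict_mono[OF p t(2) 3 hi])
    then have "(cos (p * \<tau>) / cos (q * \<tau>)) * (cos (q * \<tau>) * cos (q * T)) < (cos (p * T) / cos (q * T)) * (cos (q * \<tau>) * cos (q * T))"
      using cq cp cqp by (intro mult_strict_right_mono mult_neg_neg) auto
    then show ?thesis using cq cp cqp by (simp add: mult_ac)
  qed
qed

text \<open>
  A phase factor moves the origin to \<open>c\<close>, after which the real part is a sum of cosines of the distances
  to \<open>c\<close>.
\<close>

lemma digit_ft_zero_cos_sum:
  assumes A: "finite A" "A \<noteq> {}" and zero: "digit_ft A \<xi> = 0"
  shows "(\<Sum>a\<in>A. cos (2 * pi * \<xi> * \<bar>real_of_int a - c\<bar>)) = 0"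
proof -
  have "(\<Sum>a\<in>A. cis (- 2 * pi * \<xi> * real_of_int a)) = 0"
    using zero A by (simp add: digit_ft_eq)
  then have "0 = Re (cis (2 * pi * \<xi> * c) * (\<Sum>a\<in>A. cis (- 2 * pi * \<xi> * real_of_int a)))" by simp
  also have "\<dots> = (\<Sum>a\<in>A. cos (2 * pi * \<xi> * c + - 2 * pi * \<xi> * real_of_int a))"
    unfolding sum_distrib_left cis_mult by simp
  also have "\<dots> = (\<Sum>a\<in>A. cos (2 * pi * \<xi> * \<bar>real_of_int a - c\<bar>))"
  proof (rule sum.cong[OF refl])
    fix a
    have "cos (2 * pi * \<xi> * c + - 2 * pi * \<xi> * real_of_int a) = cos (- (2 * pi * \<xi> * (real_of_int a - c)))"
      by (rule arg_cong[of _ _ cos]) (simp add: algebra_simps)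
    also have "\<dots> = cos (2 * pi * \<xi> * \<bar>real_of_int a - c\<bar>)"
    proof (cases "0 \<le> real_of_int a - c")
      case True
      then show ?thesis by (simp only: cos_minus abs_of_nonneg)
    next
      case False
      then have "\<bar>real_of_int a - c\<bar> = - (real_of_int a - c)" by linarith
      then show ?thesis by (simp only: mult_minus_right)
    qed
    finally show "cos (2 * pi * \<xi> * c + - 2 * pi * \<xi> * real_of_int a) = cos (2 * pi * \<xi> * \<bar>real_of_int a - c\<bar>)" .
  qed
  finally show ?thesis by simp
qed

lemma centred_digit_bound:
  assumes "A \<subseteq> {0..int M - 1}" "a \<in> A"
  shows "\<bar>real_of_int a - (real M - 1) / 2\<bar> < real M / 2"
proof -
  have "0 \<le> a" "a \<le> int M - 1" using assms by auto
  then have "0 \<le> real_of_int a" "real_of_int a \<le> real M - 1" by linarith+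
  then show ?thesis unfolding abs_less_iff by (simp add: field_simps)
qed

text \<open>
  Centred at \<open>(M - 1) / 2\<close>, every digit has a distance less than \<open>M / 2\<close>, so that all the cosines are
  positive.
\<close>

lemma digit_ft_nonzero_near_0:
  assumes A: "A \<subseteq> {0..int M - 1}" "A \<noteq> {}" and M: "M > 0" and \<xi>: "\<bar>\<xi>\<bar> \<le> 1 / (2 * real M)"
  shows "digit_ft A \<xi> \<noteq> 0"
proof
  assume zero: "digit_ft A \<xi> = 0"
  have fin: "finite A" using A(1) finite_subset by blast
  have "0 < (\<Sum>a\<in>A. cos (2 * pi * \<xi> * \<bar>real_of_int a - (real M - 1) / 2\<bar>))"
  proof (rule sum_pos[OF fin A(2)])
    fix a assume "a \<in> A"
    then have a: "\<bar>real_of_int a - (real M - 1) / 2\<bar> < real M / 2"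
      by (rule centred_digit_bound[OF A(1)])
    have "\<bar>\<xi>\<bar> * \<bar>real_of_int a - (real M - 1) / 2\<bar> \<le> 1 / (2 * real M) * \<bar>real_of_int a - (real M - 1) / 2\<bar>"
      using \<xi> by (intro mult_right_mono) auto
    also have "\<dots> < 1 / (2 * real M) * (real M / 2)"
      using a M by (intro mult_strict_left_mono) auto
    also have "\<dots> = 1 / 4" using M by simp
    finally have "2 * pi * (\<bar>\<xi>\<bar> * \<bar>real_of_int a - (real M - 1) / 2\<bar>) < 2 * pi * (1 / 4)"
      by (intro mult_strict_left_mono) simp_all
    then have "\<bar>2 * pi * \<xi> * \<bar>real_of_int a - (real M - 1) / 2\<bar>\<bar> < pi / 2"
      by (simp add: abs_mult mult_ac)
    then show "0 < cos (2 * pi * \<xi> * \<bar>real_of_int a - (real M - 1) / 2\<bar>)"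
      unfolding abs_less_iff by (intro cos_gt_zero_pi) linarith+
  qed
  then show False using digit_ft_zero_cos_sum[OF fin A(2) zero] by simp
qed

text \<open>
  At two zeros \<open>\<xi> < \<eta>\<close> both cosine sums vanish, and so does any combination of them. The
  combination of \<open>cos_combination_pos\<close> with \<open>T = M / 2\<close> is positive at every digit. That \<open>\<eta>\<close> is
  less than \<open>1 / M\<close> gives \<open>q T < \<pi>\<close>, and \<open>digit_ft_nonzero_near_0\<close> gives \<open>\<pi> / 2 < p T\<close>.
\<close>

lemma digit_ft_zero_unique_aux:
  assumes A: "A \<subseteq> {0..int M - 1}" "A \<noteq> {}" and M: "M > 0"
    and \<xi>: "0 < \<xi>" "\<xi> < \<eta>" "\<eta> < 1 / real M"
    and zero: "digit_ft A \<xi> = 0" "digit_ft A \<eta> = 0"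
  shows False
proof -
  have fin: "finite A" using A(1) finite_subset by blast
  define p where "p = 2 * pi * \<xi>"
  define q where "q = 2 * pi * \<eta>"
  define T where "T = real M / 2"
  define \<tau> where "\<tau> a = \<bar>real_of_int a - (real M - 1) / 2\<bar>" for a
  have pq: "0 < p" "p < q" using \<xi> by (simp_all add: p_def q_def)
  have "\<eta> * real M < 1" using \<xi> M by (simp add: pos_less_divide_eq)
  then have hi: "q * T < pi" by (simp add: q_def T_def)
  have "\<not> \<bar>\<xi>\<bar> \<le> 1 / (2 * real M)" using digit_ft_nonzero_near_0[OF A M] zero by blast
  then have "1 / (2 * real M) < \<xi>" using \<xi> by simp
  then have "1 < \<xi> * (2 * real M)" using pos_divide_less_eq[of "2 * real M" 1 \<xi>] M by simp
  then have lo: "pi / 2 < p * T" by (simp add: p_def T_def)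
  have "0 < (\<Sum>a\<in>A. cos (p * T) * cos (q * \<tau> a) - cos (q * T) * cos (p * \<tau> a))"
  proof (rule sum_pos[OF fin A(2)])
    fix a assume "a \<in> A"
    then have "\<tau> a < T"
      unfolding \<tau>_def T_def by (rule centred_digit_bound[OF A(1)])
    then show "0 < cos (p * T) * cos (q * \<tau> a) - cos (q * T) * cos (p * \<tau> a)"
      by (intro cos_combination_pos pq lo hi) (simp_all add: \<tau>_def)
  qed
  also have "\<dots> = cos (p * T) * (\<Sum>a\<in>A. cos (q * \<tau> a)) - cos (q * T) * (\<Sum>a\<in>A. cos (p * \<tau> a))"
    by (simp add: sum_subtractf sum_distrib_left)
  also have "\<dots> = 0"
    unfolding p_def q_def \<tau>_def
    by (simp add: digit_ft_zero_cos_sum[OF fin A(2) zero(1)] digit_ft_zero_cos_sum[OF fin A(2) zero(2)])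
  finally show False by simp
qed

lemma digit_ft_zero_unique:
  assumes A: "A \<subseteq> {0..int M - 1}" "A \<noteq> {}" and M: "M > 0"
    and \<xi>: "0 < \<xi>" "\<xi> < 1 / real M" and \<eta>: "0 < \<eta>" "\<eta> < 1 / real M"
    and zero: "digit_ft A \<xi> = 0" "digit_ft A \<eta> = 0"
  shows "\<xi> = \<eta>"
  using digit_ft_zero_unique_aux[OF A M, of \<xi> \<eta>] digit_ft_zero_unique_aux[OF A M, of \<eta> \<xi>] assms
  by (cases \<xi> \<eta> rule: linorder_cases) auto

section \<open>Exponential growth for pairs that are not distributed\<close>

text \<open>
  Nonvanishing of two factors, for one pair of digit differences, is turned into nonvanishing of all
  factors at a suitable difference with the same first digits. Since the difference of words of \<open>m\<close>
  digits is less than \<open>M ^ m\<close>, its quotient by \<open>M ^ (m + 2)\<close> lies in the zero-free interval,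
  so that only the third factor of a two-digit difference has to be discussed.
\<close>

lemma persistent_difference:
  assumes A: "A \<subseteq> {0..int M - 1}" "A \<noteq> {}" and B: "B \<subseteq> {0..int M - 1}" and M: "M \<ge> 3"
    and b: "b1 \<in> B" "b1' \<in> B" "b1 \<noteq> b1'" "b2 \<in> B" "b2' \<in> B"
    and nz1: "digit_ft A (real_of_int (b1 - b1') / real M) \<noteq> 0"
    and nz2: "digit_ft A (real_of_int (b1 - b1') / real M ^ 2 + real_of_int (b2 - b2') / real M) \<noteq> 0"
  obtains c c' where "c \<in> B" "c' \<in> B"
    "\<And>s. digit_ft A (real_of_int (b1 - b1' + int M * (c - c')) / real M ^ Suc s) \<noteq> 0"
proof -
  define d where "d = b1 - b1'"
  have range: "\<bar>x - y\<bar> \<le> int M - 1" if "x \<in> B" "y \<in> B" for x y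
  proof -
    have "x \<in> {0..int M - 1}" "y \<in> {0..int M - 1}" using that B by blast+
    then have "0 \<le> x" "x \<le> int M - 1" "0 \<le> y" "y \<le> int M - 1" by auto
    then show ?thesis unfolding abs_le_iff by linarith
  qed
  have d: "d \<noteq> 0" "\<bar>d\<bar> < int M"
    using b range[OF b(1,2)] by (auto simp: d_def)
  have rM: "real M \<ge> 3" using M by simp
  \<comment> \<open>Adding \<open>M e\<close> to \<open>d\<close> changes the argument of the first factor by an integer.\<close>
  have step1: "digit_ft A (real_of_int (d + int M * e) / real M) \<noteq> 0" for e
  proof -
    have "real_of_int (d + int M * e) / real M = real_of_int d / real M + of_int e"
      using rM by (simp add: add_divide_distrib)
    then have "digit_ft A (real_of_int (d + int M * e) / real M) = digit_ft A (real_of_int d / real M)"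
      by (simp only: digit_ft_add_int)
    then show ?thesis using nz1 by (simp add: d_def)
  qed
  have large: "digit_ft A (real_of_int D / real M ^ Suc s) \<noteq> 0"
    if D: "\<bar>D\<bar> \<le> int M ^ m" and s: "m + 2 \<le> Suc s" for D m s
  proof (rule digit_ft_nonzero_near_0[OF A])
    have "\<bar>real_of_int D\<bar> = real_of_int \<bar>D\<bar>" by simp
    also have "\<dots> \<le> real_of_int (int M ^ m)" using D by (simp only: of_int_le_iff)
    finally have D': "\<bar>real_of_int D\<bar> \<le> real M ^ m" by simp
    have "real M ^ m * (2 * real M) \<le> real M ^ m * (real M * real M)"
      using rM by (intro mult_left_mono mult_right_mono) auto
    also have "\<dots> = real M ^ (m + 2)" by (simp add: power_add power2_eq_square)
    also have "\<dots> \<le> real M ^ Suc s" using s rM by (intro power_increasing) auto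
    finally have "real M ^ m / real M ^ Suc s \<le> 1 / (2 * real M)"
      using rM by (simp only: pos_divide_le_eq zero_less_power) (simp add: pos_le_divide_eq divide_simps)
    moreover have "\<bar>real_of_int D / real M ^ Suc s\<bar> \<le> real M ^ m / real M ^ Suc s"
      using D' rM by (simp add: divide_right_mono)
    ultimately show "\<bar>real_of_int D / real M ^ Suc s\<bar> \<le> 1 / (2 * real M)" by linarith
  qed (use M in simp)
  have exponents: "s = 0 \<or> s = 1 \<or> s = 2 \<or> 3 \<le> s" for s :: nat by linarith
  show thesis
  proof (cases "digit_ft A (real_of_int d / real M ^ 2) = 0")
    case False
    show thesis
    proof (rule that[of b1 b1])
      fix s :: nat
      have "s = 0 \<or> s = 1 \<or> 2 \<le> s" by linarith
      then have "digit_ft A (real_of_int d / real M ^ Suc s) \<noteq> 0"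
        using step1[of 0] False large[of d 1 s] d by (auto simp: power2_eq_square)
      then show "digit_ft A (real_of_int (b1 - b1' + int M * (b1 - b1)) / real M ^ Suc s) \<noteq> 0"
        by (simp add: d_def)
    qed (use b in auto)
  next
    case True
    define D where "D = d + int M * (b2 - b2')"
    have Dbound: "\<bar>D\<bar> \<le> int M ^ 2 - 1"
    proof -
      have e: "\<bar>b2 - b2'\<bar> \<le> int M - 1" by (rule range[OF b(4,5)])
      have "\<bar>D\<bar> \<le> \<bar>d\<bar> + int M * \<bar>b2 - b2'\<bar>"
        unfolding D_def by (rule order_trans[OF abs_triangle_ineq]) (simp add: abs_mult)
      also have "\<dots> \<le> (int M - 1) + int M * (int M - 1)"
        using d e by (intro add_mono mult_left_mono) auto
      also have "\<dots> = int M ^ 2 - 1" by (simp add: power2_eq_square algebra_simps)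
      finally show ?thesis .
    qed
    have ndvd: "\<not> int M dvd d" using d zdvd_imp_le[of "int M" "\<bar>d\<bar>"] by auto
    have "d = D - int M * (b2 - b2')" by (simp add: D_def)
    then have ndvdD: "\<not> int M dvd D" using ndvd by (metis dvd_diff dvd_triv_left)
    then have D0: "D \<noteq> 0" by auto
    have two: "digit_ft A (real_of_int D / real M ^ 2) \<noteq> 0"
    proof -
      have "real_of_int D / real M ^ 2 = real_of_int (b1 - b1') / real M ^ 2 + real_of_int (b2 - b2') / real M"
        using rM by (simp add: D_def d_def field_simps power2_eq_square)
      then show ?thesis using nz2 by simp
    qed
    have sym: "digit_ft A \<bar>\<xi>\<bar> = 0" if "digit_ft A \<xi> = 0" for \<xi>
      using digit_ft_uminus[of A \<xi>] that by (auto simp: abs_if)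
    \<comment> \<open>Two zeros in \<open>(0, 1/M)\<close> coincide, so \<open>|D| = M |d|\<close>, contradicting that \<open>M\<close> does not divide \<open>d\<close>.\<close>
    have three: "digit_ft A (real_of_int D / real M ^ 3) \<noteq> 0"
    proof
      assume z: "digit_ft A (real_of_int D / real M ^ 3) = 0"
      have Dr: "\<bar>real_of_int D\<bar> < real M ^ 2" "0 < \<bar>real_of_int D\<bar>"
      proof -
        have "\<bar>D\<bar> < int M ^ 2" using Dbound by simp
        then have "real_of_int \<bar>D\<bar> < real_of_int (int M ^ 2)" by (simp only: of_int_less_iff)
        then show "\<bar>real_of_int D\<bar> < real M ^ 2" by simp
      qed (use D0 in simp)
      have dr: "\<bar>real_of_int d\<bar> < real M" "0 < \<bar>real_of_int d\<bar>"
      proof -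
        have "real_of_int \<bar>d\<bar> < real_of_int (int M)" using d by (simp only: of_int_less_iff)
        then show "\<bar>real_of_int d\<bar> < real M" by simp
      qed (use d in simp)
      have "\<bar>real_of_int d / real M ^ 2\<bar> = \<bar>real_of_int D / real M ^ 3\<bar>"
      proof (rule digit_ft_zero_unique[OF A])
        show "digit_ft A \<bar>real_of_int d / real M ^ 2\<bar> = 0" by (rule sym[OF True])
        show "digit_ft A \<bar>real_of_int D / real M ^ 3\<bar> = 0" by (rule sym[OF z])
        show "\<bar>real_of_int d / real M ^ 2\<bar> < 1 / real M"
          using dr rM by (simp add: divide_simps power2_eq_square)
        show "\<bar>real_of_int D / real M ^ 3\<bar> < 1 / real M"
          using Dr rM by (simp add: divide_simps power2_eq_square power3_eq_cube)
        show "0 < \<bar>real_of_int d / real M ^ 2\<bar>" using d M by simp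
        show "0 < \<bar>real_of_int D / real M ^ 3\<bar>" using D0 M by simp
      qed (use M in simp)
      then have "\<bar>real_of_int d\<bar> / real M ^ 2 * real M ^ 3 = \<bar>real_of_int D\<bar> / real M ^ 3 * real M ^ 3"
        by simp
      then have "real M * \<bar>real_of_int d\<bar> = \<bar>real_of_int D\<bar>"
        using rM by (simp add: power2_eq_square power3_eq_cube mult_ac)
      then have "real_of_int (int M * \<bar>d\<bar>) = real_of_int \<bar>D\<bar>" by simp
      then have "int M * \<bar>d\<bar> = \<bar>D\<bar>" by (simp only: of_int_eq_iff)
      then have "int M dvd \<bar>D\<bar>" by (metis dvd_triv_left)
      with ndvdD show False by simp
    qed
    show thesis
    proof (rule that[of b2 b2'])
      fix s :: nat
      have "digit_ft A (real_of_int D / real M ^ Suc s) \<noteq> 0"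
        using exponents[of s] step1[of "b2 - b2'"] two three large[of D 2 s] Dbound
        by (auto simp: D_def numeral_2_eq_2 numeral_3_eq_3)
      then show "digit_ft A (real_of_int (b1 - b1' + int M * (b2 - b2')) / real M ^ Suc s) \<noteq> 0"
        by (simp add: D_def d_def)
    qed (use b in auto)
  qed
qed

text \<open>
  After finitely many factors the argument is so small that the rest of the product is within \<open>1 / 2\<close>
  of 1 by the Lipschitz bound, however many factors follow.
\<close>

lemma scale_prod_bounded_below:
  assumes A: "A \<subseteq> {0..int M - 1}" "A \<noteq> {}" and M: "M \<ge> 2"
    and nz: "\<And>s. digit_ft A (t / real M ^ Suc s) \<noteq> 0"
  obtains \<gamma> k\<^sub>0 where "\<gamma> > 0" "\<And>k. k\<^sub>0 \<le> k \<Longrightarrow> \<gamma> \<le> cmod (scale_prod M A k t)"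
proof -
  have fin: "finite A" using A(1) finite_subset by blast
  obtain k0 where k0: "4 * pi * real M * \<bar>t\<bar> < real M ^ k0"
    using real_arch_pow[of "real M"] M by auto
  have pos: "scale_prod M A k0 t \<noteq> 0"
    unfolding scale_prod_def using nz by simp
  have Mk: "0 < real M ^ k0" using M by simp
  have "cmod (scale_prod M A k0 t) / 2 \<le> cmod (scale_prod M A k t)" if k: "k0 \<le> k" for k
  proof -
    obtain m where k: "k = k0 + m" using k le_iff_add by auto
    have "2 * pi * real M * \<bar>t / real M ^ k0\<bar> \<le> 1 / 2"
      using k0 Mk by (simp add: divide_simps)
    then have "cmod (scale_prod M A m (t / real M ^ k0) - 1) \<le> 1 / 2"
      using scale_prod_lipschitz[OF A(1) M, of m "t / real M ^ k0" 0] scale_prod_0[OF fin A(2)] by simp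
    then have "1 / 2 \<le> cmod (scale_prod M A m (t / real M ^ k0))"
      using norm_triangle_ineq2[of 1 "1 - scale_prod M A m (t / real M ^ k0)"] by (simp add: norm_minus_commute)
    then have "cmod (scale_prod M A k0 t) * (1 / 2) \<le> cmod (scale_prod M A k0 t) * cmod (scale_prod M A m (t / real M ^ k0))"
      by (intro mult_left_mono) auto
    then show ?thesis by (simp add: k scale_prod_add norm_mult)
  qed
  then show thesis using that[of "cmod (scale_prod M A k0 t) / 2" k0] pos by simp
qed

text \<open>
  For a block of \<open>L\<close> digits with the difference 0 or \<open>t\<close> to a fixed word, the squares of the two
  products add up to at least about \<open>1 + \<gamma>\<^sup>2\<close>, where \<open>\<gamma>\<close> bounds the one at \<open>t\<close> below, also after a shift \<open>x\<close> by at most \<open>\<epsilon>\<close>. The inequality for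
  \<open>\<epsilon>\<close> and \<open>L\<close> says that the shift passed on to the next block is again at most \<open>\<epsilon>\<close>, which makes the gain
  iterate. The lower bound \<open>L\<^sub>0\<close> on the length leaves room for the digits that realize \<open>t\<close>.
\<close>

lemma two_branch_gain:
  assumes A: "A \<subseteq> {0..int M - 1}" "A \<noteq> {}" and M: "M \<ge> 2"
    and nz: "\<And>s. digit_ft A (t / real M ^ Suc s) \<noteq> 0"
  obtains \<epsilon> \<Lambda> L where "\<Lambda> > 1" "\<epsilon> > 0" "L \<ge> L\<^sub>0" "(\<bar>t\<bar> + \<epsilon>) / real M ^ L \<le> \<epsilon>"
    "\<And>x. \<bar>x\<bar> \<le> \<epsilon> \<Longrightarrow> \<Lambda> \<le> (cmod (scale_prod M A L x))\<^sup>2 + (cmod (scale_prod M A L (x + t)))\<^sup>2"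
proof -
  have fin: "finite A" using A(1) finite_subset by blast
  obtain \<gamma> k0 where \<gamma>: "\<gamma> > 0" and low: "\<And>k. k0 \<le> k \<Longrightarrow> \<gamma> \<le> cmod (scale_prod M A k t)"
    using scale_prod_bounded_below[OF A M nz] by blast
  have \<gamma>1: "\<gamma> \<le> 1" using low[of k0] cmod_scale_prod_le_1[of M A k0 t] by simp
  define K where "K = 2 * pi * real M"
  have K: "K > 0" using M by (simp add: K_def)
  \<comment> \<open>The perturbation \<open>K * \<epsilon> = \<gamma>\<^sup>2 / 8\<close> costs at most \<open>\<gamma>\<^sup>2 / 2\<close> in the sum of the two squares.\<close>
  define \<epsilon> where "\<epsilon> = \<gamma>\<^sup>2 / (8 * K)"
  have \<epsilon>: "\<epsilon> > 0" using \<gamma> K by (simp add: \<epsilon>_def)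
  have K\<epsilon>: "K * \<epsilon> = \<gamma>\<^sup>2 / 8" using K by (simp add: \<epsilon>_def)
  have \<gamma>2: "\<gamma>\<^sup>2 \<le> \<gamma>" using \<gamma> \<gamma>1 by (simp add: power2_eq_square mult_left_le)
  obtain k1 where k1: "(\<bar>t\<bar> + \<epsilon>) / \<epsilon> < real M ^ k1"
    using real_arch_pow[of "real M"] M by auto
  define L where "L = max L\<^sub>0 (max k0 k1)"
  have "real M ^ k1 \<le> real M ^ L"
    using M by (intro power_increasing) (auto simp: L_def)
  then have "(\<bar>t\<bar> + \<epsilon>) / \<epsilon> \<le> real M ^ L" using k1 by linarith
  then have small: "(\<bar>t\<bar> + \<epsilon>) / real M ^ L \<le> \<epsilon>"
    using \<epsilon> M by (simp add: pos_divide_le_eq mult.commute)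
  have gain: "1 + \<gamma>\<^sup>2 / 2 \<le> (cmod (scale_prod M A L x))\<^sup>2 + (cmod (scale_prod M A L (x + t)))\<^sup>2"
    if x: "\<bar>x\<bar> \<le> \<epsilon>" for x
  proof -
    have Kx: "K * \<bar>x\<bar> \<le> \<gamma>\<^sup>2 / 8" using x K K\<epsilon> by (metis mult_le_cancel_left_pos)
    have "cmod (scale_prod M A L x - 1) \<le> \<gamma>\<^sup>2 / 8"
      using scale_prod_lipschitz[OF A(1) M, of L x 0] scale_prod_0[OF fin A(2)] Kx by (simp add: K_def)
    then have a: "1 - \<gamma>\<^sup>2 / 8 \<le> cmod (scale_prod M A L x)"
      using norm_triangle_ineq2[of 1 "1 - scale_prod M A L x"] by (simp add: norm_minus_commute)
    have "cmod (scale_prod M A L (x + t) - scale_prod M A L t) \<le> \<gamma>\<^sup>2 / 8"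
      using scale_prod_lipschitz[OF A(1) M, of L "x + t" t] Kx by (simp add: K_def)
    moreover have "\<gamma> \<le> cmod (scale_prod M A L t)" by (rule low) (simp add: L_def)
    ultimately have b: "\<gamma> - \<gamma>\<^sup>2 / 8 \<le> cmod (scale_prod M A L (x + t))"
      using norm_triangle_ineq2[of "scale_prod M A L t" "scale_prod M A L t - scale_prod M A L (x + t)"]
      by (simp add: norm_minus_commute)
    have "(1 - \<gamma>\<^sup>2 / 8)\<^sup>2 \<le> (cmod (scale_prod M A L x))\<^sup>2"
      using a \<gamma>1 \<gamma>2 by (intro power_mono) auto
    moreover have "(\<gamma> - \<gamma>\<^sup>2 / 8)\<^sup>2 \<le> (cmod (scale_prod M A L (x + t)))\<^sup>2"
      using b \<gamma> \<gamma>2 by (intro power_mono) auto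
    moreover have "1 + \<gamma>\<^sup>2 / 2 \<le> (1 - \<gamma>\<^sup>2 / 8)\<^sup>2 + (\<gamma> - \<gamma>\<^sup>2 / 8)\<^sup>2"
    proof -
      have "(1 - \<gamma>\<^sup>2 / 8)\<^sup>2 \<ge> 1 - \<gamma>\<^sup>2 / 4" by (simp add: power2_diff)
      moreover have "(\<gamma> - \<gamma>\<^sup>2 / 8)\<^sup>2 \<ge> \<gamma>\<^sup>2 - \<gamma>\<^sup>2 / 4"
      proof -
        have "\<gamma> * \<gamma>\<^sup>2 \<le> 1 * \<gamma>\<^sup>2" using \<gamma>1 by (intro mult_right_mono) auto
        then show ?thesis using zero_le_power2[of "\<gamma>\<^sup>2 / 8"] unfolding power2_diff by linarith
      qed
      ultimately show ?thesis by linarith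
    qed
    ultimately show ?thesis by linarith
  qed
  show thesis
    by (rule that[OF _ \<epsilon> _ small gain]) (use \<gamma> in \<open>auto simp: L_def\<close>)
qed

text \<open>
  The first word holds the less significant digits. The value beyond \<open>k + m\<close> keeps the result in the
  extensional function space \<open>digits\<close>.
\<close>

definition append_digits :: "nat \<Rightarrow> nat \<Rightarrow> (nat \<Rightarrow> int) \<Rightarrow> (nat \<Rightarrow> int) \<Rightarrow> nat \<Rightarrow> int" where
  "append_digits k m u v = (\<lambda>j. if j < k then u j else if j < k + m then v (j - k) else undefined)"

lemma append_digits_mem:
  assumes "u \<in> digits B k" "v \<in> digits B m"
  shows "append_digits k m u v \<in> digits B (k + m)"
  using assms by (auto simp: append_digits_def digits_def PiE_iff extensional_def)

lemma digit_value_append: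
  "digit_value M (k + m) (append_digits k m u v) = digit_value M k u + int M ^ k * digit_value M m v"
  unfolding digit_value_add by (simp add: digit_value_def append_digits_def)

lemma append_digits_inj:
  "inj_on (\<lambda>(u, v). append_digits k m u v) (digits B k \<times> digits B m)"
proof (rule inj_onI, clarify)
  fix u v u' v'
  assume mem: "u \<in> digits B k" "v \<in> digits B m" "u' \<in> digits B k" "v' \<in> digits B m"
    and eq: "append_digits k m u v = append_digits k m u' v'"
  have "u j = u' j" if "j < k" for j
    using fun_cong[OF eq, of j] that by (simp add: append_digits_def)
  moreover have "v j = v' j" if "j < m" for j
    using fun_cong[OF eq, of "k + j"] that by (simp add: append_digits_def)
  ultimately show "u = u' \<and> v = v'"
    using mem digits_eqI[of u B k u'] digits_eqI[of v B m v'] by blast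
qed

text \<open>
  The fixed word \<open>b'\<close> is \<open>w'\<close> repeated \<open>m\<close> times. Only the words made of blocks \<open>w\<close> and \<open>w'\<close> are
  needed for the estimate. The shift \<open>x\<close> stands for the contribution of less significant blocks, and has to be
  general for the induction.
\<close>

lemma column_growth:
  fixes D :: int
  assumes M: "M > 0" and B: "finite B"
    and w: "w \<in> digits B L" "w' \<in> digits B L" "digit_value M L w - digit_value M L w' = D" "D \<noteq> 0"
    and small: "(\<bar>real_of_int D\<bar> + \<epsilon>) / real M ^ L \<le> \<epsilon>"
    and gain: "\<And>x. \<bar>x\<bar> \<le> \<epsilon> \<Longrightarrow> \<Lambda> \<le> (cmod (scale_prod M A L x))\<^sup>2 + (cmod (scale_prod M A L (x + real_of_int D)))\<^sup>2"
    and \<Lambda>: "0 \<le> \<Lambda>"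
  shows "\<exists>b'\<in>digits B (m * L). \<forall>x. \<bar>x\<bar> \<le> \<epsilon> \<longrightarrow>
    \<Lambda> ^ m \<le> (\<Sum>b\<in>digits B (m * L). (cmod (scale_prod M A (m * L) (x + real_of_int (digit_value M (m * L) b - digit_value M (m * L) b'))))\<^sup>2)"
proof (induction m)
  case 0
  show ?case
    by (rule bexI[of _ "\<lambda>_. undefined"]) (auto simp: digits_def scale_prod_def)
next
  case (Suc m)
  define k where "k = m * L"
  define val where "val b = digit_value M k b" for b
  obtain b' where b': "b' \<in> digits B k" and IH: "\<And>x. \<bar>x\<bar> \<le> \<epsilon> \<Longrightarrow>
      \<Lambda> ^ m \<le> (\<Sum>b\<in>digits B k. (cmod (scale_prod M A k (x + real_of_int (val b - val b'))))\<^sup>2)"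
    using Suc.IH unfolding k_def[symmetric] val_def by blast
  define c' where "c' = append_digits L k w' b'"
  define F where "F x b = (cmod (scale_prod M A (L + k) (x + real_of_int (digit_value M (L + k) b - digit_value M (L + k) c'))))\<^sup>2"
    for x b
  have ww': "w \<noteq> w'" using w by auto
  have "\<Lambda> ^ Suc m \<le> (\<Sum>b\<in>digits B (L + k). F x b)" if x: "\<bar>x\<bar> \<le> \<epsilon>" for x
  proof -
    have F: "F x (append_digits L k u b) = (cmod (scale_prod M A L (x + \<delta>)))\<^sup>2 *
        (cmod (scale_prod M A k ((x + \<delta>) / real M ^ L + real_of_int (val b - val b'))))\<^sup>2"
      if \<delta>: "\<delta> = real_of_int (digit_value M L u - digit_value M L w')" for u b \<delta>
    proof -
      have "x + real_of_int (digit_value M (L + k) (append_digits L k u b) - digit_value M (L + k) c')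
          = (x + \<delta>) + real M ^ L * of_int (val b - val b')"
        by (simp add: c'_def digit_value_append val_def \<delta> algebra_simps)
      then show ?thesis
        unfolding F_def by (simp only: scale_prod_split[OF M] norm_mult power_mult_distrib)
    qed
    have branch: "(cmod (scale_prod M A L (x + \<delta>)))\<^sup>2 * \<Lambda> ^ m \<le> (\<Sum>b\<in>digits B k. F x (append_digits L k u b))"
      if \<delta>: "\<delta> = real_of_int (digit_value M L u - digit_value M L w')" "\<bar>\<delta>\<bar> \<le> \<bar>real_of_int D\<bar>" for u \<delta>
    proof -
      have "\<bar>(x + \<delta>) / real M ^ L\<bar> = \<bar>x + \<delta>\<bar> / real M ^ L" by simp
      also have "\<dots> \<le> (\<bar>real_of_int D\<bar> + \<epsilon>) / real M ^ L"
        using x \<delta>(2) by (intro divide_right_mono) auto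
      also have "\<dots> \<le> \<epsilon>" by (rule small)
      finally have "\<Lambda> ^ m \<le> (\<Sum>b\<in>digits B k. (cmod (scale_prod M A k ((x + \<delta>) / real M ^ L + real_of_int (val b - val b'))))\<^sup>2)"
        by (rule IH)
      then have "(cmod (scale_prod M A L (x + \<delta>)))\<^sup>2 * \<Lambda> ^ m \<le> (cmod (scale_prod M A L (x + \<delta>)))\<^sup>2 *
          (\<Sum>b\<in>digits B k. (cmod (scale_prod M A k ((x + \<delta>) / real M ^ L + real_of_int (val b - val b'))))\<^sup>2)"
        by (intro mult_left_mono) auto
      also have "\<dots> = (\<Sum>b\<in>digits B k. F x (append_digits L k u b))"
        unfolding F[OF \<delta>(1)] sum_distrib_left ..
      finally show ?thesis .
    qed
    \<comment> \<open>The first block is \<open>w'\<close> or \<open>w\<close>; the remaining blocks are handled by the induction hypothesis.\<close>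
    have "\<Lambda> ^ Suc m \<le> ((cmod (scale_prod M A L x))\<^sup>2 + (cmod (scale_prod M A L (x + real_of_int D)))\<^sup>2) * \<Lambda> ^ m"
      using gain[OF x] \<Lambda> by (simp add: mult_right_mono)
    also have "\<dots> \<le> (\<Sum>b\<in>digits B k. F x (append_digits L k w' b)) + (\<Sum>b\<in>digits B k. F x (append_digits L k w b))"
      unfolding distrib_right using branch[of 0 w'] branch[of "real_of_int D" w] w(3) by (intro add_mono) auto
    also have "\<dots> = (\<Sum>u\<in>{w', w}. \<Sum>b\<in>digits B k. F x (append_digits L k u b))"
      using ww' by simp
    also have "\<dots> = (\<Sum>(u, b)\<in>{w', w} \<times> digits B k. F x (append_digits L k u b))"
      by (rule sum.cartesian_product)
    also have "\<dots> = (\<Sum>c\<in>(\<lambda>(u, b). append_digits L k u b) ` ({w', w} \<times> digits B k). F x c)"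
    proof -
      have "inj_on (\<lambda>(u, b). append_digits L k u b) ({w', w} \<times> digits B k)"
        by (rule inj_on_subset[OF append_digits_inj[of L k B]]) (use w in auto)
      then show ?thesis by (simp add: sum.reindex case_prod_unfold)
    qed
    also have "\<dots> \<le> (\<Sum>b\<in>digits B (L + k). F x b)"
      using w by (intro sum_mono2 finite_digits B) (auto simp: F_def append_digits_mem)
    finally show ?thesis .
  qed
  moreover have "c' \<in> digits B (L + k)"
    unfolding c'_def by (intro append_digits_mem w b')
  ultimately show ?case
    unfolding F_def k_def mult_Suc by blast
qed

text \<open>
  The adjoint is applied to the column of \<open>b'\<close>. For digits in \<open>{0, \<dots>, M - 1}\<close> words correspond to
  residues, so that the result consists exactly of the inner products of this column with all the others.
\<close>

lemma uncertainty_norm_sq_ge_column: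
  assumes M: "M > 0" and A: "A \<subseteq> {0..int M - 1}" "A \<noteq> {}" and B: "B \<subseteq> {0..int M - 1}"
    and b': "b' \<in> digits B k"
  shows "(real (card A) / real M) ^ k *
      (\<Sum>b\<in>digits B k. (cmod (scale_prod M A k (real_of_int (digit_value M k b - digit_value M k b'))))\<^sup>2)
      \<le> (uncertainty_norm M A B k)\<^sup>2"
proof -
  define N where "N = M ^ k"
  define val where "val b = digit_value M k b" for b
  define X where "X = residues_of N (digit_set M A k)"
  define Y where "Y = residues_of N (digit_set M B k)"
  define n where "n = real (card A ^ k)"
  define l' where "l' = residue N (val b')"
  have finA: "finite A" using A(1) finite_subset by blast
  have n: "n > 0" using finA A(2) by (simp add: n_def card_gt_0_iff)
  have N: "N > 0" using M by (simp add: N_def)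
  have XY: "X \<subseteq> {..<N}" "Y \<subseteq> {..<N}" using N by (simp_all add: X_def Y_def residues_subset)
  have sumX: "(\<Sum>j\<in>X. f j) = (\<Sum>a\<in>digits A k. f (residue N (val a)))" for f :: "nat \<Rightarrow> complex"
    unfolding X_def residues_of_digit_set N_def val_def
    by (simp only: sum.reindex[OF residue_digit_value_inj[OF A(1)]] o_def)
  have sumY: "(\<Sum>l\<in>Y. f l) = (\<Sum>b\<in>digits B k. f (residue N (val b)))" for f :: "nat \<Rightarrow> real"
    unfolding Y_def residues_of_digit_set N_def val_def
    by (simp only: sum.reindex[OF residue_digit_value_inj[OF B]] o_def)
  have cardX: "real (card X) = n"
    unfolding X_def residues_of_digit_set N_def n_def
    by (simp only: card_image[OF residue_digit_value_inj[OF A(1)]] card_digits)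
  define g where "g j = cis (- 2 * pi * real j * real l' / real N)" for j :: nat
  have inner: "(\<Sum>j\<in>X. cis (2 * pi * real j * real l / real N) * g j) = of_real n * scale_prod M A k (real l' - real l)" for l
  proof -
    have "cis (2 * pi * real j * real l / real N) * g j = cis (- 2 * pi * real j * real_of_int (int l' - int l) / real N)" for j
      unfolding g_def cis_mult by (simp add: add_divide_distrib[symmetric] diff_divide_distrib[symmetric] algebra_simps)
    then have "(\<Sum>j\<in>X. cis (2 * pi * real j * real l / real N) * g j)
        = (\<Sum>a\<in>digits A k. cis (- 2 * pi * real_of_int (val a) * real_of_int (int l' - int l) / real N))"
      by (simp only: sumX cis_residue[OF N])
    also have "\<dots> = of_real n * scale_prod M A k (real_of_int (int l' - int l))"
      unfolding val_def N_def sum_digits_cis[OF finA A(2) M] by (simp add: n_def)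
    finally show ?thesis by simp
  qed
  have "(\<Sum>l\<in>Y. (cmod (of_real n * scale_prod M A k (real l' - real l)))\<^sup>2)
      \<le> (l2_op_norm (localized_dft N X Y))\<^sup>2 * real N * (\<Sum>j\<in>X. (cmod (g j))\<^sup>2)"
    using localized_dft_adjoint_le[OF XY N, of g] unfolding inner .
  also have "(\<Sum>j\<in>X. (cmod (g j))\<^sup>2) = n" by (simp add: g_def cardX)
  also have "(\<Sum>l\<in>Y. (cmod (of_real n * scale_prod M A k (real l' - real l)))\<^sup>2)
      = n\<^sup>2 * (\<Sum>b\<in>digits B k. (cmod (scale_prod M A k (real_of_int (val b - val b'))))\<^sup>2)"
  proof -
    have "cmod (scale_prod M A k (real l' - real (residue N (val b)))) = cmod (scale_prod M A k (real_of_int (val b - val b')))" for b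
    proof -
      have "scale_prod M A k (real l' - real (residue N (val b))) = cnj (scale_prod M A k (real (residue N (val b)) - real l'))"
        using scale_prod_uminus[of M A k "real (residue N (val b)) - real l'"] by simp
      also have "scale_prod M A k (real (residue N (val b)) - real l') = scale_prod M A k (real_of_int (val b - val b'))"
        unfolding l'_def N_def by (rule scale_prod_residue_diff[OF M])
      finally show ?thesis by simp
    qed
    then show ?thesis
      by (simp add: sumY norm_mult power_mult_distrib sum_distrib_left)
  qed
  finally have "n * (n * (\<Sum>b\<in>digits B k. (cmod (scale_prod M A k (real_of_int (val b - val b'))))\<^sup>2))
      \<le> n * ((l2_op_norm (localized_dft N X Y))\<^sup>2 * real N)"
    by (simp add: power2_eq_square mult_ac)
  then have "n * (\<Sum>b\<in>digits B k. (cmod (scale_prod M A k (real_of_int (val b - val b'))))\<^sup>2)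
      \<le> (l2_op_norm (localized_dft N X Y))\<^sup>2 * real N"
    using n by (simp only: mult_le_cancel_left_pos)
  then have "n * (\<Sum>b\<in>digits B k. (cmod (scale_prod M A k (real_of_int (val b - val b'))))\<^sup>2) / real N
      \<le> (l2_op_norm (localized_dft N X Y))\<^sup>2"
    using N by (simp only: pos_divide_le_eq of_nat_0_less_iff)
  moreover have "(real (card A) / real M) ^ k = n / real N"
    by (simp add: n_def N_def power_divide)
  ultimately show ?thesis
    by (simp add: uncertainty_norm_eq X_def Y_def N_def val_def)
qed

section \<open>The uncertainty exponent\<close>

lemma le_one_if_powers_bounded:
  fixes x :: real
  assumes "\<And>m. 1 \<le> m \<Longrightarrow> x ^ m \<le> K"
  shows "x \<le> 1"
proof (rule ccontr)
  assume "\<not> x \<le> 1"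
  then obtain m where "max K 1 < x ^ m" using real_arch_pow[of x "max K 1"] by fastforce
  moreover from this have "1 \<le> m" by (cases m) auto
  ultimately show False using assms[of m] by simp
qed

definition admissible_exponents :: "nat \<Rightarrow> int set \<Rightarrow> int set \<Rightarrow> real set" where
  "admissible_exponents M A B =
     {\<beta>. \<exists>C>0. \<forall>k\<ge>1. uncertainty_norm M A B k \<le> C * real M powr (- real k * \<beta>)}"

lemma uncertainty_exponent_eq: "uncertainty_exponent M A B = Sup (admissible_exponents M A B)"
  by (simp add: uncertainty_exponent_def admissible_exponents_def)

lemma powr_neg_mult_sq:
  fixes M :: nat
  assumes "M > 0"
  shows "(real M powr (- real k * \<beta>))\<^sup>2 = (real M powr (- 2 * \<beta>)) ^ k"
proof -
  have "(real M powr (- real k * \<beta>))\<^sup>2 = real M powr (real 2 * (- real k * \<beta>))"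
    using assms by (simp only: powr_realpow[symmetric] powr_powr mult.commute powr_gt_zero of_nat_0_less_iff)
  also have "\<dots> = (real M powr (- 2 * \<beta>)) ^ k"
    using assms by (simp add: powr_realpow[symmetric] powr_powr mult_ac)
  finally show ?thesis .
qed

lemma admissible_exponent_sq_bound:
  assumes M: "M > 0" and \<beta>: "\<beta> \<in> admissible_exponents M A B"
  obtains C where "C > 0" "\<And>k. 1 \<le> k \<Longrightarrow> (uncertainty_norm M A B k)\<^sup>2 \<le> C * (real M powr (- 2 * \<beta>)) ^ k"
proof -
  obtain C where C: "C > 0" "\<And>k. 1 \<le> k \<Longrightarrow> uncertainty_norm M A B k \<le> C * real M powr (- real k * \<beta>)"
    using \<beta> unfolding admissible_exponents_def by blast
  have "(uncertainty_norm M A B k)\<^sup>2 \<le> C\<^sup>2 * (real M powr (- 2 * \<beta>)) ^ k" if "1 \<le> k" for k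
    using power_mono[OF C(2)[OF that] uncertainty_norm_nonneg[OF M], of 2]
    unfolding power_mult_distrib powr_neg_mult_sq[OF M] .
  then show thesis using that[of "C\<^sup>2"] C by simp
qed

text \<open>
  The trivial bound \<open>sqrt (M ^ k)\<close> suffices to have one element, so that the supremum is meaningful.
\<close>

lemma admissible_exponents_nonempty:
  assumes M: "M > 0"
  shows "- 1 / 2 \<in> admissible_exponents M A B"
proof -
  have "uncertainty_norm M A B k \<le> 1 * real M powr (- real k * (- 1 / 2))" for k
  proof -
    have "uncertainty_norm M A B k \<le> sqrt (real (M ^ k))"
      unfolding uncertainty_norm_eq using M by (intro localized_dft_op_norm_le_sqrt residues_subset) auto
    also have "\<dots> = (real M powr real k) powr (1 / 2)"
      using M by (simp add: powr_half_sqrt powr_realpow)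
    also have "\<dots> = real M powr (- real k * (- 1 / 2))"
      by (simp add: powr_powr)
    finally show ?thesis by simp
  qed
  then show ?thesis unfolding admissible_exponents_def by (intro CollectI exI[of _ 1]) auto
qed

lemma powr_critical_exponent:
  assumes "M \<ge> 2" "0 < n"
  shows "real M powr (- 2 * ((1 - ln (real n) / ln (real M)) / 2)) = real n / real M"
proof -
  have "- 2 * ((1 - z) / 2) = z - 1" for z :: real by simp
  then have "- 2 * ((1 - ln (real n) / ln (real M)) / 2) = ln (real n) / ln (real M) - 1" .
  moreover have "real M powr (ln (real n) / ln (real M)) = real n"
    using assms by (simp add: powr_def)
  ultimately show ?thesis using assms by (simp only: powr_diff) simp
qed

lemma distributed_uncertainty_exponent:
  assumes M: "M \<ge> 3" and A: "finite A" and B: "finite B" and card: "1 < card A" "card A = card B"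
    and dist: "distributed_spectral_pair M A B"
  shows "uncertainty_exponent M A B = (1 - ln (real (card A)) / ln (real M)) / 2"
proof -
  define n where "n = card A"
  define \<beta>\<^sub>0 where "\<beta>\<^sub>0 = (1 - ln (real n) / ln (real M)) / 2"
  define r where "r = real n / real M"
  have Mpos: "M > 0" and n: "n > 0" using M card by (auto simp: n_def)
  have ne: "A \<noteq> {}" "B \<noteq> {}" using card by auto
  have r: "real M powr (- 2 * \<beta>\<^sub>0) = r"
    unfolding \<beta>\<^sub>0_def r_def by (rule powr_critical_exponent) (use M n in auto)
  have rpos: "r > 0" using n Mpos by (simp add: r_def)
  have "Sup (admissible_exponents M A B) = \<beta>\<^sub>0"
  proof (rule cSup_eq_maximum)
    have "uncertainty_norm M A B k \<le> sqrt (real n) * real M powr (- real k * \<beta>\<^sub>0)" if k: "1 \<le> k" for k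
    proof -
      obtain k' where k': "k = Suc k'" using k by (cases k) auto
      have "uncertainty_norm M A B k \<le> sqrt (real n ^ Suc (Suc k') / real M ^ Suc k')"
        unfolding k' n_def by (rule distributed_uncertainty_norm_le[OF dist Mpos A ne(1) B card(2)])
      also have "real n ^ Suc (Suc k') / real M ^ Suc k' = real n * (real M powr (- real k * \<beta>\<^sub>0))\<^sup>2"
        unfolding powr_neg_mult_sq[OF Mpos] r by (simp add: r_def k' power_divide)
      also have "sqrt \<dots> = sqrt (real n) * real M powr (- real k * \<beta>\<^sub>0)"
        by (simp add: real_sqrt_mult)
      finally show ?thesis .
    qed
    then show "\<beta>\<^sub>0 \<in> admissible_exponents M A B"
      unfolding admissible_exponents_def using n by (intro CollectI exI[of _ "sqrt (real n)"]) simp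
  next
    fix \<beta> assume \<beta>: "\<beta> \<in> admissible_exponents M A B"
    obtain C where C: "C > 0" "\<And>k. 1 \<le> k \<Longrightarrow> (uncertainty_norm M A B k)\<^sup>2 \<le> C * (real M powr (- 2 * \<beta>)) ^ k"
      by (rule admissible_exponent_sq_bound[OF Mpos \<beta>]) (rule that)
    define q where "q = real M powr (- 2 * \<beta>)"
    have q: "q > 0" using Mpos by (simp add: q_def)
    have "(r / q) ^ k \<le> real n * C" if k: "1 \<le> k" for k
    proof -
      obtain k' where k': "k = Suc k'" using k by (cases k) auto
      have "r ^ k / real n = real (card B ^ k') / real M ^ k"
        using n by (simp add: r_def k' power_divide n_def card)
      also have "\<dots> \<le> real (card (residues_of (M ^ k) (digit_set M B k))) / real M ^ k"
        unfolding k' using distributed_card_residues_ge[OF dist Mpos A ne(1) B ne(2)]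
        by (intro divide_right_mono) (simp_all only: of_nat_le_iff zero_le_power of_nat_0_le_iff)
      also have "\<dots> \<le> (uncertainty_norm M A B k)\<^sup>2"
        by (rule uncertainty_norm_sq_ge_card[OF Mpos ne(1)])
      also have "\<dots> \<le> C * q ^ k" using C(2)[OF k] by (simp add: q_def)
      finally show ?thesis using n q by (simp add: power_divide field_simps)
    qed
    then have "r / q \<le> 1" by (rule le_one_if_powers_bounded)
    then have "real M powr (- 2 * \<beta>\<^sub>0) \<le> real M powr (- 2 * \<beta>)"
      using q unfolding r q_def[symmetric] by simp
    then show "\<beta> \<le> \<beta>\<^sub>0" using M by simp
  qed
  then show ?thesis by (simp add: uncertainty_exponent_eq \<beta>\<^sub>0_def n_def)
qed

text \<open>
  The difference of \<open>persistent_difference\<close> is realized by words of length \<open>L\<close> that share all digits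
  but the first two.
\<close>

lemma non_distributed_exponential_gain:
  assumes M: "M \<ge> 3" and A: "A \<subseteq> {0..int M - 1}" "A \<noteq> {}" and B: "B \<subseteq> {0..int M - 1}"
    and card: "card A = card B" and non_dist: "\<not> distributed_spectral_pair M A B"
  obtains L \<Lambda> where "L \<ge> 1" "\<Lambda> > 1"
    "\<And>m. (real (card A) / real M) ^ (m * L) * \<Lambda> ^ m \<le> (uncertainty_norm M A B (m * L))\<^sup>2"
proof -
  have fin: "finite A" "finite B" using A(1) B finite_subset by blast+
  have M2: "M \<ge> 2" and Mpos: "M > 0" using M by auto
  obtain b1 b1' b2 b2' where b: "b1 \<in> B" "b1' \<in> B" "b1 \<noteq> b1'" "b2 \<in> B" "b2' \<in> B"
    and nz: "digit_ft A (real_of_int (b1 - b1') / real M) \<noteq> 0"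
      "digit_ft A (real_of_int (b1 - b1') / real M ^ 2 + real_of_int (b2 - b2') / real M) \<noteq> 0"
    using non_dist fin card unfolding distributed_spectral_pair_def by blast
  obtain c c' where c: "c \<in> B" "c' \<in> B"
    and persistent: "\<And>s. digit_ft A (real_of_int (b1 - b1' + int M * (c - c')) / real M ^ Suc s) \<noteq> 0"
    by (rule persistent_difference[OF A B M b nz]) (rule that)
  define D where "D = b1 - b1' + int M * (c - c')"
  obtain \<epsilon> \<Lambda> L where \<Lambda>: "\<Lambda> > 1" and \<epsilon>: "\<epsilon> > 0" and L: "L \<ge> 2"
    and small: "(\<bar>real_of_int D\<bar> + \<epsilon>) / real M ^ L \<le> \<epsilon>"
    and gain: "\<And>x. \<bar>x\<bar> \<le> \<epsilon> \<Longrightarrow> \<Lambda> \<le> (cmod (scale_prod M A L x))\<^sup>2 + (cmod (scale_prod M A L (x + real_of_int D)))\<^sup>2"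
    by (rule two_branch_gain[OF A M2 persistent[folded D_def], of 2]) (rule that)
  define word where "word x y = (\<lambda>j. if j < L then (if j = 0 then x else if j = 1 then y else b1) else undefined)"
    for x y :: int
  have word: "word x y \<in> digits B L" if "x \<in> B" "y \<in> B" for x y
    using that b by (auto simp: word_def digits_def PiE_iff extensional_def)
  have diff: "digit_value M L (word b1 c) - digit_value M L (word b1' c') = D"
  proof -
    obtain L' where L': "L = Suc (Suc L')" using L by (metis add_2_eq_Suc le_Suc_ex)
    have "digit_value M L (word x y) = x + int M * (y + int M * digit_value M L' (\<lambda>_. b1))" for x y
    proof -
      have "digit_value M L' (\<lambda>j. word x y (Suc (Suc j))) = digit_value M L' (\<lambda>_. b1)"
        unfolding digit_value_def by (intro sum.cong) (auto simp: word_def L')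
      then show ?thesis by (simp add: L' digit_value_Suc_left) (simp add: word_def L')
    qed
    then show ?thesis by (simp add: D_def algebra_simps)
  qed
  \<comment> \<open>Otherwise the two words would have the same first digit.\<close>
  have "D \<noteq> 0"
  proof
    assume "D = 0"
    have dig: "a j \<in> {0..<int M}" if "a \<in> digits B L" "j < L" for a j
      using that B by (fastforce simp: digits_def PiE_iff)
    have "word b1 c 0 = word b1' c' 0"
      by (rule digit_value_inj[where k = L and M = M]) (use \<open>D = 0\<close> diff L dig word b c in auto)
    then show False using b L by (simp add: word_def)
  qed
  note growth = column_growth[OF Mpos fin(2) word[OF b(1) c(1)] word[OF b(2) c(2)] diff this small gain]
  have "(real (card A) / real M) ^ (m * L) * \<Lambda> ^ m \<le> (uncertainty_norm M A B (m * L))\<^sup>2" for m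
  proof -
    obtain b' where b': "b' \<in> digits B (m * L)" and le: "\<forall>x. \<bar>x\<bar> \<le> \<epsilon> \<longrightarrow> \<Lambda> ^ m \<le> (\<Sum>b\<in>digits B (m * L).
        (cmod (scale_prod M A (m * L) (x + real_of_int (digit_value M (m * L) b - digit_value M (m * L) b'))))\<^sup>2)"
      using growth[of m] \<Lambda> by auto
    have "(real (card A) / real M) ^ (m * L) * \<Lambda> ^ m \<le> (real (card A) / real M) ^ (m * L) *
        (\<Sum>b\<in>digits B (m * L). (cmod (scale_prod M A (m * L) (real_of_int (digit_value M (m * L) b - digit_value M (m * L) b'))))\<^sup>2)"
      using le[rule_format, of 0] \<epsilon> by (intro mult_left_mono) auto
    also have "\<dots> \<le> (uncertainty_norm M A B (m * L))\<^sup>2"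
      by (rule uncertainty_norm_sq_ge_column[OF Mpos A B b'])
    finally show ?thesis .
  qed
  then show thesis using that[of L \<Lambda>] L \<Lambda> by simp
qed

text \<open>
  The additional factor \<open>\<Lambda>\<close> per \<open>L\<close> digits in the square of the norm lowers every admissible exponent
  by \<open>\<eta> = ln \<Lambda> / (2 L ln M)\<close>.
\<close>

lemma non_distributed_uncertainty_exponent:
  assumes M: "M \<ge> 3" and A: "A \<subseteq> {0..int M - 1}" "A \<noteq> {}" and B: "B \<subseteq> {0..int M - 1}"
    and card: "card A = card B" and non_dist: "\<not> distributed_spectral_pair M A B"
  shows "uncertainty_exponent M A B < (1 - ln (real (card A)) / ln (real M)) / 2"
proof -
  define \<beta>\<^sub>0 where "\<beta>\<^sub>0 = (1 - ln (real (card A)) / ln (real M)) / 2"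
  define r where "r = real (card A) / real M"
  have M2: "M \<ge> 2" and Mpos: "M > 0" using M by auto
  have "finite A" using A(1) finite_subset by blast
  then have n: "0 < card A" using A(2) by (simp add: card_gt_0_iff)
  have r: "real M powr (- 2 * \<beta>\<^sub>0) = r"
    unfolding \<beta>\<^sub>0_def r_def by (rule powr_critical_exponent[OF M2 n])
  obtain L \<Lambda> where L: "L \<ge> 1" and \<Lambda>: "\<Lambda> > 1"
    and lower: "\<And>m. r ^ (m * L) * \<Lambda> ^ m \<le> (uncertainty_norm M A B (m * L))\<^sup>2"
    by (rule non_distributed_exponential_gain[OF M A B card non_dist, folded r_def]) (rule that)
  define \<eta> where "\<eta> = ln \<Lambda> / (2 * real L * ln (real M))"
  have lnM: "ln (real M) > 0" using M by simp
  have \<eta>: "\<eta> > 0" using \<Lambda> L lnM by (simp add: \<eta>_def)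
  have "uncertainty_exponent M A B \<le> \<beta>\<^sub>0 - \<eta>"
    unfolding uncertainty_exponent_eq
  proof (rule cSup_least)
    show "admissible_exponents M A B \<noteq> {}" using admissible_exponents_nonempty[OF Mpos] by blast
  next
    fix \<beta> assume \<beta>: "\<beta> \<in> admissible_exponents M A B"
    obtain C where C: "C > 0" "\<And>k. 1 \<le> k \<Longrightarrow> (uncertainty_norm M A B k)\<^sup>2 \<le> C * (real M powr (- 2 * \<beta>)) ^ k"
      by (rule admissible_exponent_sq_bound[OF Mpos \<beta>]) (rule that)
    define q where "q = real M powr (- 2 * \<beta>)"
    have q: "q > 0" using Mpos by (simp add: q_def)
    have "(r ^ L * \<Lambda> / q ^ L) ^ m \<le> C" if m: "1 \<le> m" for m
    proof -
      have "r ^ (m * L) * \<Lambda> ^ m \<le> C * q ^ (m * L)"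
        using lower[of m] C(2)[of "m * L"] m L by (simp add: q_def)
      then show ?thesis
        using q by (simp add: power_divide power_mult_distrib power_mult[symmetric] mult.commute[of m] pos_divide_le_eq)
    qed
    then have "r ^ L * \<Lambda> / q ^ L \<le> 1" by (rule le_one_if_powers_bounded)
    then have le: "r ^ L * \<Lambda> \<le> q ^ L" using q by simp
    have "real M powr (- 2 * real L * (\<beta>\<^sub>0 - \<eta>)) = r ^ L * \<Lambda>"
    proof -
      have "- 2 * real L * (\<beta>\<^sub>0 - \<eta>) = real L * (- 2 * \<beta>\<^sub>0) + ln \<Lambda> / ln (real M)"
        using L lnM by (simp add: \<eta>_def field_simps)
      moreover have "real M powr (ln \<Lambda> / ln (real M)) = \<Lambda>"
        using \<Lambda> M by (simp add: powr_def)
      moreover have "real M powr (real L * (- 2 * \<beta>\<^sub>0)) = r ^ L"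
        using Mpos by (simp add: r[symmetric] powr_realpow[symmetric] powr_powr mult_ac)
      ultimately show ?thesis by (simp only: powr_add)
    qed
    also note le
    also have "q ^ L = real M powr (- 2 * real L * \<beta>)"
      using Mpos by (simp add: q_def powr_realpow[symmetric] powr_powr mult_ac)
    finally have "- 2 * real L * (\<beta>\<^sub>0 - \<eta>) \<le> - 2 * real L * \<beta>"
      using M by simp
    then show "\<beta> \<le> \<beta>\<^sub>0 - \<eta>" using L by simp
  qed
  then show ?thesis using \<eta> unfolding \<beta>\<^sub>0_def[symmetric] by linarith
qed

theorem theorem2p1:
  fixes M :: nat
  assumes "M \<ge> 3"
  shows "(\<forall>(A::int set) (B::int set) (\<delta>::real).
            finite A \<longrightarrow> finite B \<longrightarrow> 1 < card A \<longrightarrow> card A = card B \<longrightarrow> card A < M \<longrightarrow>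
            \<delta> = ln (real (card A)) / ln (real M) \<longrightarrow>
            distributed_spectral_pair M A B \<longrightarrow>
            uncertainty_exponent M A B = (1 - \<delta>) / 2)
       \<and> (\<forall>(A::int set) (B::int set) (\<delta>::real).
            A \<subseteq> {0..int M - 1} \<longrightarrow> B \<subseteq> {0..int M - 1} \<longrightarrow>
            1 < card A \<longrightarrow> card A = card B \<longrightarrow> card A < M \<longrightarrow>
            \<delta> = ln (real (card A)) / ln (real M) \<longrightarrow>
            uncertainty_exponent M A B = (1 - \<delta>) / 2 \<longrightarrow>
            distributed_spectral_pair M A B)"
proof (intro conjI allI impI)
  fix A B :: "int set" and \<delta> :: real
  assume "finite A" "finite B" "1 < card A" "card A = card B"
    "\<delta> = ln (real (card A)) / ln (real M)" "distributed_spectral_pair M A B"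
  then show "uncertainty_exponent M A B = (1 - \<delta>) / 2"
    using distributed_uncertainty_exponent[OF assms] by simp
next
  fix A B :: "int set" and \<delta> :: real
  assume AB: "A \<subseteq> {0..int M - 1}" "B \<subseteq> {0..int M - 1}" "1 < card A" "card A = card B"
    and exponent: "\<delta> = ln (real (card A)) / ln (real M)" "uncertainty_exponent M A B = (1 - \<delta>) / 2"
  show "distributed_spectral_pair M A B"
  proof (rule ccontr)
    assume "\<not> distributed_spectral_pair M A B"
    then have "uncertainty_exponent M A B < (1 - \<delta>) / 2"
      using non_distributed_uncertainty_exponent[OF assms AB(1) _ AB(2,4)] AB(3) exponent(1) by fastforce
    then show False using exponent(2) by simp
  qed
qed

end
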